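(* Let $X$ be a Banach space and let $c\ge1$. Consider, for $d\ge 1$, the following properties: $(iv_d)$ $\widetilde{\operatorname{ca}}(x_n)\le d\,\widetilde\delta(x_n)$ for each bounded sequence $(x_n)$ in $X$; $(vi_d)$ for any $\delta\in(0,2]$, any $\varepsilon>0$ and any normalized $\delta$-separated sequence in $X$ there is a subsequence which is $(\frac{2d}{\delta}+\varepsilon)$-equivalent to the standard basis of $\ell_1$. Then (1) $(iv_c)\iff(vi_c)$ if $X$ is a real space; (2) $(vi_c)\implies(iv_c)\implies(vi_{\pi c/2})$ if $X$ is a complex space.
   Context: $X$ is a Banach space over $\mathbb F\in\{\mathbb R,\mathbb C\}$. For a bounded sequence put $\operatorname{ca}(x_n)=\inf_{n}\operatorname{diam}\{x_k: k\ge n\}$ (also for scalar sequences), $\widetilde{\operatorname{ca}}(x_n)=\inf\{\operatorname{ca}(x_{n_k}): (n_k)\text{ strictly increasing}\}$, $\delta(x_n)=\sup\{\operatorname{ca}(x^*(x_n)): x^*\in B_{X^*}\}$, $\widetilde\delta(x_n)=\inf\{\delta(x_{n_k}): (n_k)\text{ strictly increasing}\}$. A sequence is normalized if all its terms have norm one, and $\delta$-separated if $\|x_n-x_m\|\ge\delta$ for $n\ne m$. A normalized sequence $(y_j)$ is $K$-equivalent to the standard basis of $\ell_1$ (over $\mathbb F$) if $\frac1K\sum_{j=1}^m|\alpha_j|\le\|\sum_{j=1}^m\alpha_jy_j\|$ for all $m\in\mathbb N$ and $\alpha_1,\dots,\alpha_m\in\mathbb F$ (the upper estimate $\|\sum\alpha_jy_j\|\le\sum|\alpha_j|$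 being automatic). *)

theory Defs
  imports "HOL-Analysis.Analysis"
begin

text \<open>
  Complex normed spaces are real normed spaces with a compatible multiplication by complex
  scalars; completeness only concerns the underlying metric.
\<close>

class complex_normed_vector = real_normed_vector +
  fixes scaleC :: "complex \<Rightarrow> 'a \<Rightarrow> 'a"
  assumes scaleC_add_right: "scaleC a (x + y) = scaleC a x + scaleC a y"
    and scaleC_add_left: "scaleC (a + b) x = scaleC a x + scaleC b x"
    and scaleC_scaleC: "scaleC a (scaleC b x) = scaleC (a * b) x"
    and scaleC_of_real: "scaleC (complex_of_real r) x = scaleR r x"
    and norm_scaleC: "norm (scaleC a x) = cmod a * norm x"

class complex_banach = complex_normed_vector + banach

definition ca :: "(nat \<Rightarrow> 'a::metric_space) \<Rightarrow> real" where
  "ca x = (INF n. diameter (x ` {n..}))"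

definition ca_tilde :: "(nat \<Rightarrow> 'a::metric_space) \<Rightarrow> real" where
  "ca_tilde x = (INF r\<in>{r::nat \<Rightarrow> nat. strict_mono r}. ca (x \<circ> r))"

text \<open>
  The notions below depend on the scalar field \<open>'k\<close>, which enters through the scalar
  multiplication \<open>s\<close>; it is instantiated with \<open>scaleR\<close> or \<open>scaleC\<close>.
  Since \<open>bounded_linear\<close> only refers to real scalars, homogeneity over \<open>'k\<close> is required
  separately.
\<close>

definition dual_ball ::
    "('k::real_normed_field \<Rightarrow> 'a::real_normed_vector \<Rightarrow> 'a) \<Rightarrow> ('a \<Rightarrow> 'k) set" where
  "dual_ball s = {f. bounded_linear f \<and> (\<forall>a x. f (s a x) = a * f x) \<and> onorm f \<le> 1}"

definition delta ::
    "('k::real_normed_field \<Rightarrow> 'a::real_normed_vector \<Rightarrow> 'a) \<Rightarrow> (nat \<Rightarrow> 'a) \<Rightarrow> real" where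
  "delta s x = (SUP f\<in>dual_ball s. ca (\<lambda>n. f (x n)))"

definition delta_tilde ::
    "('k::real_normed_field \<Rightarrow> 'a::real_normed_vector \<Rightarrow> 'a) \<Rightarrow> (nat \<Rightarrow> 'a) \<Rightarrow> real" where
  "delta_tilde s x = (INF r\<in>{r::nat \<Rightarrow> nat. strict_mono r}. delta s (x \<circ> r))"

definition normalized :: "(nat \<Rightarrow> 'a::real_normed_vector) \<Rightarrow> bool" where
  "normalized x \<longleftrightarrow> (\<forall>n. norm (x n) = 1)"

definition separated :: "real \<Rightarrow> (nat \<Rightarrow> 'a::real_normed_vector) \<Rightarrow> bool" where
  "separated \<delta> x \<longleftrightarrow> (\<forall>n m. n \<noteq> m \<longrightarrow> \<delta> \<le> norm (x n - x m))"

text \<open>The upper estimate with constant one is automatic for normalized sequences.\<close>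

definition equivalent_l1_basis ::
    "('k::real_normed_field \<Rightarrow> 'a::real_normed_vector \<Rightarrow> 'a) \<Rightarrow> real \<Rightarrow> (nat \<Rightarrow> 'a) \<Rightarrow> bool" where
  "equivalent_l1_basis s K y \<longleftrightarrow> normalized y \<and>
    (\<forall>m::nat. \<forall>\<alpha>::nat \<Rightarrow> 'k.
      1 / K * (\<Sum>j<m. norm (\<alpha> j)) \<le> norm (\<Sum>j<m. s (\<alpha> j) (y j)))"

definition property_iv ::
    "('k::real_normed_field \<Rightarrow> 'a::real_normed_vector \<Rightarrow> 'a) \<Rightarrow> real \<Rightarrow> bool" where
  "property_iv s d \<longleftrightarrow>
    (\<forall>x::nat \<Rightarrow> 'a. bounded (range x) \<longrightarrow> ca_tilde x \<le> d * delta_tilde s x)"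

definition property_vi ::
    "('k::real_normed_field \<Rightarrow> 'a::real_normed_vector \<Rightarrow> 'a) \<Rightarrow> real \<Rightarrow> bool" where
  "property_vi s d \<longleftrightarrow>
    (\<forall>\<delta>\<in>{0<..2}. \<forall>\<epsilon>>0. \<forall>x::nat \<Rightarrow> 'a. normalized x \<and> separated \<delta> x \<longrightarrow>
      (\<exists>r::nat \<Rightarrow> nat. strict_mono r \<and> equivalent_l1_basis s (2 * d / \<delta> + \<epsilon>) (x \<circ> r)))"

end

theory Submission
  imports Defs "HOL-Library.Ramsey"
begin

text \<open>
  Both implications pass through lower \<open>\<ell>\<^sub>1\<close>-estimates
  \<open>L * (\<Sum>j<m. norm (\<alpha> j)) \<le> norm (\<Sum>j<m. s (\<alpha> j) (y j))\<close>.

  From \<open>property_iv\<close> to \<open>property_vi\<close>: a normalized \<open>\<delta>\<close>-separated sequence has \<open>ca_tilde \<ge> \<delta>\<close>, so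
  for \<open>d < \<delta> / c\<close> every subsequence admits a functional of the dual ball along which it
  oscillates by more than \<open>d\<close>. The claim is then a quantitative form of Rosenthal's \<open>\<ell>\<^sub>1\<close>-theorem. By compactness of
  bounded sets of scalars, two approximate cluster values \<open>z\<close>, \<open>w\<close> with \<open>dist z w\<close> almost \<open>d\<close> can
  be fixed once and for all on a suitable subsequence, and Rosenthal's combinatorial argument
  (\<open>independent_subsequence\<close>) gives a further subsequence on which every finite pattern of
  values close to \<open>z\<close> or \<open>w\<close> is taken by a functional of the dual ball. The difference of the
  functionals for two complementary patterns has norm at most 2 and takes values close to
  \<open>\<sigma> j * (z - w)\<close> for prescribed signs \<open>\<sigma> j\<close>; hence, up to small errors,
  \<open>d / 2 * norm (\<Sum>j<m. \<sigma> j * \<alpha> j)\<close> is a lower bound for the norm of the linear combination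
  (\<open>l1_lower_estimate_subsequence\<close>). The best signs recover the fraction 1 of
  \<open>\<Sum>j<m. norm (\<alpha> j)\<close> for real scalars, and at least \<open>2 / pi\<close> for complex scalars by averaging over
  rotations, which is the origin of the factor \<open>pi / 2\<close>.

  From \<open>property_vi\<close> to \<open>property_iv\<close>: with \<open>\<theta> = ca_tilde x > 0\<close>, Ramsey's theorem gives subsequences
  that are almost \<open>\<theta>\<close>-separated, and one may assume that the norms converge to some \<open>l > 0\<close>. Normalizing
  the terms gives an almost \<open>\<theta> / l\<close>-separated sequence, so by assumption and after
  undoing the normalization a subsequence satisfies a lower \<open>\<ell>\<^sub>1\<close>-estimate with constant
  almost \<open>\<theta> / (2 * c)\<close>. A Hahn--Banach argument yields a functional of the dual ball whose values
  on this subsequence are alternately plus and minus this constant, so that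
  \<open>delta s x\<close> is at least almost \<open>\<theta> / c\<close>.
\<close>

section \<open>Independent subsequences\<close>

text \<open>
  The family \<open>C\<close> encodes the sequence of pairs \<open>(C True n, C False n)\<close> of sets. A point \<open>f\<close> oscillates along
  \<open>N\<close> if it lies in sets of either kind for infinitely many indices of \<open>N\<close>.
\<close>

definition oscillates :: "(bool \<Rightarrow> nat \<Rightarrow> 'c set) \<Rightarrow> 'c \<Rightarrow> nat set \<Rightarrow> bool" where
  "oscillates C f N \<longleftrightarrow> (\<forall>b. infinite {n\<in>N. f \<in> C b n})"

text \<open>
  For every \<open>K\<close> in the family \<open>\<K>\<close>, some point of \<open>K\<close> oscillates along each given infinite
  subset of \<open>M\<close>: no subsequence of the pairs with indices in \<open>M\<close> converges pointwise on \<open>K\<close>.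
\<close>

definition hereditarily_oscillating :: "(bool \<Rightarrow> nat \<Rightarrow> 'c set) \<Rightarrow> 'c set set \<Rightarrow> nat set \<Rightarrow> bool" where
  "hereditarily_oscillating C \<K> M \<longleftrightarrow> (\<forall>K\<in>\<K>. \<forall>N\<subseteq>M. infinite N \<longrightarrow> (\<exists>f\<in>K. oscillates C f N))"

lemma oscillates_almost_subset:
  assumes "oscillates C f N" "finite (N - M)"
  shows "oscillates C f M"
  unfolding oscillates_def
proof
  fix b
  have "{n\<in>N. f \<in> C b n} \<subseteq> {n\<in>M. f \<in> C b n} \<union> (N - M)" by auto
  with assms show "infinite {n\<in>M. f \<in> C b n}"
    unfolding oscillates_def by (metis finite_UnI finite_subset)
qed

text \<open>
  The inductive step of Rosenthal's argument. If it failed, then one could choose indices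
  \<open>m 0 < m 1 < \<dots>\<close> and decreasing infinite sets \<open>P j\<close> such that no point of some
  \<open>K \<inter> C b (m j)\<close> oscillates along \<open>P j\<close>. The same \<open>(K, b)\<close> occurs for infinitely many \<open>j\<close>,
  and the corresponding indices \<open>m j\<close> form a set \<open>N\<close> along which some \<open>f \<in> K\<close> oscillates. This \<open>f\<close>
  lies in some \<open>C b (m j)\<close>, and \<open>N\<close> is almost contained in \<open>P j\<close>, a contradiction.
\<close>

lemma hereditarily_oscillating_split:
  assumes fin: "finite \<K>" and inf: "infinite M" and her: "hereditarily_oscillating C \<K> M"
  shows "\<exists>m\<in>M. \<exists>M'\<subseteq>M. infinite M' \<and> (\<forall>n\<in>M'. m < n) \<and>
           hereditarily_oscillating C ((\<lambda>(K, b). K \<inter> C b m) ` (\<K> \<times> UNIV)) M'"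
proof (rule ccontr)
  assume neg: "\<not> ?thesis"
  then have neg': "\<not> hereditarily_oscillating C ((\<lambda>(K, b). K \<inter> C b m) ` (\<K> \<times> UNIV)) M'"
    if "m \<in> M" "M' \<subseteq> M" "infinite M'" "\<forall>n\<in>M'. m < n" for m M'
    using that by blast
  have step: "\<exists>K\<in>\<K>. \<exists>b. \<exists>N\<subseteq>{n\<in>P. m < n}. infinite N \<and> (\<forall>f\<in>K \<inter> C b m. \<not> oscillates C f N)"
    if P: "P \<subseteq> M" "infinite P" and m: "m \<in> M" for P m
  proof -
    have "{n\<in>P. m < n} = P - {..m}" by auto
    with P have "infinite {n\<in>P. m < n}" by simp
    moreover have "{n\<in>P. m < n} \<subseteq> M" using P by auto
    ultimately have "\<not> hereditarily_oscillating C ((\<lambda>(K, b). K \<inter> C b m) ` (\<K> \<times> UNIV)) {n\<in>P. m < n}"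
      using neg' m by simp
    then obtain K' N where *: "K' \<in> (\<lambda>(K, b). K \<inter> C b m) ` (\<K> \<times> UNIV)"
        "N \<subseteq> {n\<in>P. m < n}" "infinite N" "\<forall>f\<in>K'. \<not> oscillates C f N"
      unfolding hereditarily_oscillating_def by blast
    from *(1) obtain K b where "K \<in> \<K>" "K' = K \<inter> C b m" by auto
    with *(2-4) show ?thesis by blast
  qed
  define good where "good = (\<lambda>(m, P, K, b). m \<in> M \<and> P \<subseteq> M \<and> infinite P \<and> (\<forall>n\<in>P. m < n) \<and>
      K \<in> \<K> \<and> (\<forall>f\<in>K \<inter> C b m. \<not> oscillates C f P))"
  have ex: "\<exists>P K b. good (m, P, K, b) \<and> P \<subseteq> Q"
    if "Q \<subseteq> M" "infinite Q" "m \<in> M" for Q m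
  proof -
    from step[OF that] obtain K b N where *: "K \<in> \<K>" "N \<subseteq> {n\<in>Q. m < n}" "infinite N"
        "\<forall>f\<in>K \<inter> C b m. \<not> oscillates C f N" by blast
    then have "good (m, N, K, b)" "N \<subseteq> Q" using that(1,3) unfolding good_def by auto
    then show ?thesis by blast
  qed
  have "\<exists>g. \<forall>n::nat. good (g n) \<and> (fst (g (Suc n)) \<in> fst (snd (g n)) \<and>
      fst (snd (g (Suc n))) \<subseteq> fst (snd (g n)))"
  proof (rule dependent_nat_choice)
    obtain m where "m \<in> M" using inf by fastforce
    then show "\<exists>x. good x" using ex[of M m] inf by auto
  next
    fix x and n :: nat assume x: "good x"
    obtain m P K b where xe: "x = (m, P, K, b)" by (cases x)
    from x have P: "P \<subseteq> M" "infinite P" by (auto simp: good_def xe)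
    then obtain m' where m': "m' \<in> P" by fastforce
    then have "m' \<in> M" using P by auto
    from ex[OF P this] obtain P' K' b' where "good (m', P', K', b')" "P' \<subseteq> P" by auto
    then show "\<exists>y. good y \<and> fst y \<in> fst (snd x) \<and> fst (snd y) \<subseteq> fst (snd x)"
      using m' by (intro exI[of _ "(m', P', K', b')"]) (auto simp: xe)
  qed
  then obtain g where g: "\<And>n. good (g n)" "\<And>n. fst (g (Suc n)) \<in> fst (snd (g n))"
      "\<And>n. fst (snd (g (Suc n))) \<subseteq> fst (snd (g n))" by blast
  define m P k where "m = (\<lambda>n. fst (g n))" "P = (\<lambda>n. fst (snd (g n)))" "k = (\<lambda>n. snd (snd (g n)))"
  note d = m_P_k_def
  have mM: "m n \<in> M" and kK: "fst (k n) \<in> \<K>" and mP: "i \<in> P n \<Longrightarrow> m n < i"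
    and no: "f \<in> fst (k n) \<Longrightarrow> f \<in> C (snd (k n)) (m n) \<Longrightarrow> \<not> oscillates C f (P n)"
    for n f i
    using g(1)[of n] by (auto simp: good_def d case_prod_beta)
  have decP: "P j \<subseteq> P i" if "i \<le> j" for i j
    using lift_Suc_antimono_le[of P, OF _ that] g(3) by (simp add: d)
  have mem: "m j \<in> P i" if "i < j" for i j
  proof -
    from that obtain j' where j': "j = Suc j'" "i \<le> j'" by (cases j) auto
    show ?thesis using g(2)[of j'] decP[OF j'(2)] j'(1) by (auto simp: d)
  qed
  have sm: "strict_mono m" by (rule strict_monoI) (use mem mP in blast)
  have "finite (k ` UNIV)"
    by (rule finite_subset[of _ "\<K> \<times> UNIV"])
       (use kK fin in \<open>simp_all add: image_subset_iff mem_Times_iff\<close>)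
  from pigeonhole_infinite[OF infinite_UNIV_nat this] obtain j0 where
    J: "infinite {j. k j = k j0}" by auto
  define N where "N = m ` {j. k j = k j0}"
  have "infinite N" unfolding N_def
    using J finite_imageD strict_mono_imp_inj_on[OF sm] inj_on_subset by blast
  moreover have "N \<subseteq> M" using mM by (auto simp: N_def)
  ultimately obtain f where f: "f \<in> fst (k j0)" "oscillates C f N"
    using her kK unfolding hereditarily_oscillating_def by blast
  from f(2) have "infinite {n\<in>N. f \<in> C (snd (k j0)) n}" by (auto simp: oscillates_def)
  then obtain n where "n \<in> N" "f \<in> C (snd (k j0)) n" using not_finite_existsD by auto
  then obtain j where j: "k j = k j0" "f \<in> C (snd (k j)) (m j)" by (auto simp: N_def)
  have "N - P j \<subseteq> m ` {..j}"
    unfolding N_def using mem[of j] not_le by blast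
  then have "finite (N - P j)" by (rule finite_subset) simp
  with f(2) have "oscillates C f (P j)" by (rule oscillates_almost_subset)
  moreover have "f \<in> fst (k j)" using f(1) j(1) by simp
  ultimately show False using no j(2) by blast
qed

text \<open>
  Starting from the family \<open>{S}\<close>, each splitting step intersects all members with both
  \<open>C True (r n)\<close> and \<open>C False (r n)\<close>; the members of the families obtained are nonempty and
  exhaust all finite patterns.
\<close>

lemma independent_subsequence:
  assumes "infinite M" and "hereditarily_oscillating C {S} M"
  shows "\<exists>r::nat \<Rightarrow> nat. strict_mono r \<and> range r \<subseteq> M \<and> (\<forall>m \<sigma>. \<exists>f\<in>S. \<forall>j<m. f \<in> C (\<sigma> j) (r j))"
proof -
  define good where "good = (\<lambda>(\<K>, P). finite \<K> \<and> infinite P \<and> P \<subseteq> M \<and> hereditarily_oscillating C \<K> P)"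
  define rel where "rel = (\<lambda>x y. \<exists>m. m \<in> snd x \<and> snd y \<subseteq> snd x \<and> (\<forall>n\<in>snd y. m < n) \<and>
      fst y = (\<lambda>(K, b). K \<inter> C b m) ` (fst x \<times> UNIV))"
  have "\<exists>g. \<forall>n::nat. (good (g n) \<and> (n = 0 \<longrightarrow> g n = ({S}, M))) \<and> rel (g n) (g (Suc n))"
  proof (rule dependent_nat_choice)
    show "\<exists>x. good x \<and> ((0::nat) = 0 \<longrightarrow> x = ({S}, M))"
      using assms by (simp add: good_def)
  next
    fix x and n :: nat assume "good x \<and> (n = 0 \<longrightarrow> x = ({S}, M))"
    then have x: "good x" ..
    obtain \<K> P where xe: "x = (\<K>, P)" by (cases x)
    from x have "finite \<K>" "infinite P" "hereditarily_oscillating C \<K> P" and PM: "P \<subseteq> M"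
      by (auto simp: good_def xe)
    from hereditarily_oscillating_split[OF this(1-3)] obtain m P' where
      "m \<in> P" "P' \<subseteq> P" "infinite P'" "\<forall>n\<in>P'. m < n"
      "hereditarily_oscillating C ((\<lambda>(K, b). K \<inter> C b m) ` (\<K> \<times> UNIV)) P'" by blast
    note m = this
    let ?y = "((\<lambda>(K, b). K \<inter> C b m) ` (\<K> \<times> UNIV), P')"
    have "good ?y" using m \<open>finite \<K>\<close> PM by (auto simp: good_def)
    moreover have "rel x ?y" unfolding rel_def xe fst_conv snd_conv using m by blast
    ultimately show "\<exists>y. (good y \<and> (Suc n = 0 \<longrightarrow> y = ({S}, M))) \<and> rel x y" by blast
  qed
  then obtain g where g: "\<And>n. good (g n)" "g 0 = ({S}, M)" "\<And>n. rel (g n) (g (Suc n))" by blast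
  define \<K> P where "\<K> = (\<lambda>n. fst (g n))" "P = (\<lambda>n. snd (g n))"
  have gP: "infinite (P n)" "P n \<subseteq> M" "hereditarily_oscillating C (\<K> n) (P n)" for n
    using g(1)[of n] by (simp_all add: good_def \<K>_P_def case_prod_beta)
  have "\<forall>n. \<exists>m. m \<in> P n \<and> P (Suc n) \<subseteq> P n \<and> (\<forall>i\<in>P (Suc n). m < i) \<and>
      \<K> (Suc n) = (\<lambda>(K, b). K \<inter> C b m) ` (\<K> n \<times> UNIV)"
    unfolding \<K>_P_def by (rule allI, rule g(3)[unfolded rel_def])
  from choice[OF this] obtain r where *: "\<forall>n. r n \<in> P n \<and> P (Suc n) \<subseteq> P n \<and>
      (\<forall>i\<in>P (Suc n). r n < i) \<and> \<K> (Suc n) = (\<lambda>(K, b). K \<inter> C b (r n)) ` (\<K> n \<times> UNIV)" ..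
  have r: "r n \<in> P n" "i \<in> P (Suc n) \<Longrightarrow> r n < i" for n i using * by simp_all
  have \<K>_Suc: "\<K> (Suc n) = (\<lambda>(K, b). K \<inter> C b (r n)) ` (\<K> n \<times> UNIV)" for n
    using * by simp
  have "strict_mono r"
    unfolding strict_mono_Suc_iff using r(2)[OF r(1)] by simp
  moreover have "range r \<subseteq> M"
    using r(1) gP(2) by blast
  moreover have "\<exists>f\<in>S. \<forall>j<m. f \<in> C (\<sigma> j) (r j)" for m \<sigma>
  proof -
    have "{f\<in>S. \<forall>j<m. f \<in> C (\<sigma> j) (r j)} \<in> \<K> m" for m
    proof (induction m)
      case 0
      then show ?case using g(2) by (simp add: \<K>_P_def)
    next
      case (Suc m)
      have "{f\<in>S. \<forall>j<Suc m. f \<in> C (\<sigma> j) (r j)}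
          = {f\<in>S. \<forall>j<m. f \<in> C (\<sigma> j) (r j)} \<inter> C (\<sigma> m) (r m)"
        by (auto simp: less_Suc_eq)
      also have "\<dots> \<in> \<K> (Suc m)"
        unfolding \<K>_Suc by (rule image_eqI[of _ _ "({f\<in>S. \<forall>j<m. f \<in> C (\<sigma> j) (r j)}, \<sigma> m)"]) (use Suc in simp_all)
      finally show ?case .
    qed
    then have "\<forall>N\<subseteq>P m. infinite N \<longrightarrow> (\<exists>f\<in>{f\<in>S. \<forall>j<m. f \<in> C (\<sigma> j) (r j)}. oscillates C f N)"
      by (rule bspec[OF gP(3)[unfolded hereditarily_oscillating_def]])
    then show ?thesis using gP(1)[of m] by fastforce
  qed
  ultimately show ?thesis by blast
qed

text \<open>
  The index \<open>p\<close> of the family along which a point oscillates may be chosen independently of the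
  infinite set, after passing to a subset.
\<close>

lemma hereditarily_oscillating_for_one_of_finitely_many:
  fixes C :: "'p \<Rightarrow> bool \<Rightarrow> nat \<Rightarrow> 'c set"
  assumes "finite Q" and osc: "\<And>N. infinite N \<Longrightarrow> \<exists>f\<in>S. \<exists>p\<in>Q. oscillates (C p) f N"
  shows "\<exists>p\<in>Q. \<exists>M. infinite M \<and> hereditarily_oscillating (C p) {S} M"
proof (rule ccontr)
  assume neg: "\<not> ?thesis"
  have refine: "\<exists>N\<subseteq>M. infinite N \<and> (\<forall>f\<in>S. \<not> oscillates (C p) f N)"
    if "p \<in> Q" "infinite M" for p M
  proof -
    have "\<not> hereditarily_oscillating (C p) {S} M" using neg that by blast
    then show ?thesis unfolding hereditarily_oscillating_def by blast
  qed
  have "F \<subseteq> Q \<Longrightarrow> \<exists>M. infinite M \<and> (\<forall>p\<in>F. \<forall>f\<in>S. \<not> oscillates (C p) f M)" if "finite F" for F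
    using that
  proof (induction F rule: finite_induct)
    case empty
    show ?case using infinite_UNIV_nat by blast
  next
    case (insert p F)
    then obtain M where M: "infinite M" "\<And>p f. p \<in> F \<Longrightarrow> f \<in> S \<Longrightarrow> \<not> oscillates (C p) f M"
      by auto
    have "p \<in> Q" using insert.prems by simp
    from refine[OF this M(1)] obtain N where N: "N \<subseteq> M" "infinite N"
      "\<And>f. f \<in> S \<Longrightarrow> \<not> oscillates (C p) f N" by auto
    have "N - M = {}" using N(1) by blast
    then have fin: "finite (N - M)" by (metis finite.emptyI)
    have "\<not> oscillates (C p') f N" if "p' \<in> F" "f \<in> S" for p' f
      using M(2)[OF that] by (rule contrapos_nn) (rule oscillates_almost_subset[OF _ fin])
    with N(2,3) show ?case by (intro exI[of _ N]) auto
  qed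
  from this[OF assms(1)] obtain M where "infinite M" "\<forall>p\<in>Q. \<forall>f\<in>S. \<not> oscillates (C p) f M" by auto
  with osc[of M] show False by auto
qed

section \<open>Norm-dominated functionals and convex cones\<close>

text \<open>
  Subadditive and positively homogeneous real functions; the inequality required for scaling
  implies equality.
\<close>

definition sublinear :: "('a::real_vector \<Rightarrow> real) \<Rightarrow> bool" where
  "sublinear p \<longleftrightarrow> (\<forall>x y. p (x + y) \<le> p x + p y) \<and> (\<forall>t>0. \<forall>x. p (t *\<^sub>R x) \<le> t * p x)"

lemma sublinear_add: "sublinear p \<Longrightarrow> p (x + y) \<le> p x + p y"
  by (simp add: sublinear_def)

lemma sublinear_scale: "sublinear p \<Longrightarrow> t > 0 \<Longrightarrow> p (t *\<^sub>R x) = t * p x"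
proof (rule antisym)
  assume p: "sublinear p" and t: "t > 0"
  show "p (t *\<^sub>R x) \<le> t * p x" using p t by (simp add: sublinear_def)
  have "p (inverse t *\<^sub>R (t *\<^sub>R x)) \<le> inverse t * p (t *\<^sub>R x)"
    using p t unfolding sublinear_def by (meson positive_imp_inverse_positive)
  then show "t * p x \<le> p (t *\<^sub>R x)" using t by (simp add: field_simps)
qed

lemma sublinear_0: "sublinear p \<Longrightarrow> p 0 = 0"
  using sublinear_scale[of p 2 0] by simp

lemma sublinear_neg_le: "sublinear p \<Longrightarrow> - p (- x) \<le> p x"
  using sublinear_add[of p x "- x"] sublinear_0[of p] by simp

lemma sublinear_minimal_exists:
  assumes p: "sublinear p"
  shows "\<exists>g. sublinear g \<and> g \<le> p \<and> (\<forall>q. sublinear q \<longrightarrow> q \<le> g \<longrightarrow> q = g)"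
proof -
  define A where "A = {q. sublinear q \<and> q \<le> p}"
  \<comment> \<open>The order is reversed, since Zorn's lemma produces maximal elements.\<close>
  define P where "P = (\<lambda>f g :: 'a \<Rightarrow> real. g \<le> f)"
  have "\<exists>m\<in>A. \<forall>a\<in>A. P m a \<longrightarrow> a = m"
  proof (rule predicate_Zorn)
    show "partial_order_on A (relation_of P A)"
      by (rule partial_order_on_relation_ofI) (auto simp: P_def)
  next
    fix C assume C: "C \<in> Chains (relation_of P A)"
    then have CA: "C \<subseteq> A" and ch: "\<And>f g. f \<in> C \<Longrightarrow> g \<in> C \<Longrightarrow> f \<le> g \<or> g \<le> f"
      by (auto simp: Chains_def relation_of_def P_def)
    show "\<exists>u\<in>A. \<forall>a\<in>C. P a u"
    proof (cases "C = {}")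
      case True
      then show ?thesis using p by (auto simp: A_def)
    next
      case False
      define u where "u = (\<lambda>x. INF f\<in>C. f x)"
      have low: "- p (- x) \<le> f x" if "f \<in> C" for f x
      proof -
        have "sublinear f" "f (- x) \<le> p (- x)" using that CA by (auto simp: A_def le_fun_def)
        then show ?thesis using sublinear_neg_le[of f x] by simp
      qed
      have ule: "u x \<le> f x" if "f \<in> C" for f x
        unfolding u_def using that low by (auto intro!: cINF_lower bdd_belowI2)
      have uge: "c \<le> u x" if "\<And>f. f \<in> C \<Longrightarrow> c \<le> f x" for c x
        unfolding u_def using that False by (auto intro!: cINF_greatest)
      have "sublinear u"
        unfolding sublinear_def
      proof (intro conjI allI impI)
        fix x y
        have 1: "u (x + y) \<le> f x + h y" if "f \<in> C" "h \<in> C" for f h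
        proof -
          obtain k where k: "k \<in> C" "k \<le> f" "k \<le> h"
            using ch[OF \<open>f \<in> C\<close> \<open>h \<in> C\<close>] \<open>f \<in> C\<close> \<open>h \<in> C\<close> by blast
          have "u (x + y) \<le> k (x + y)" by (rule ule[OF k(1)])
          also have "\<dots> \<le> k x + k y" using k(1) CA by (auto simp: A_def intro: sublinear_add)
          also have "\<dots> \<le> f x + h y" using k by (intro add_mono) (auto simp: le_fun_def)
          finally show ?thesis .
        qed
        have "u (x + y) - f x \<le> u y" if "f \<in> C" for f
          by (rule uge) (use 1[OF that] in \<open>simp add: diff_le_eq add.commute\<close>)
        then have "u (x + y) - u y \<le> u x"
          by (intro uge) (simp add: algebra_simps)
        then show "u (x + y) \<le> u x + u y" by simp
      next
        fix t :: real and x assume t: "t > 0"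
        have "u (t *\<^sub>R x) / t \<le> u x"
        proof (rule uge)
          fix f assume f: "f \<in> C"
          then have "f (t *\<^sub>R x) = t * f x" using CA t by (auto simp: A_def sublinear_scale)
          then show "u (t *\<^sub>R x) / t \<le> f x" using ule[OF f, of "t *\<^sub>R x"] t
            by (simp add: field_simps)
        qed
        then show "u (t *\<^sub>R x) \<le> t * u x" using t by (simp add: field_simps)
      qed
      moreover have "u \<le> p"
      proof -
        from False obtain f where "f \<in> C" by auto
        then have "u \<le> f" "f \<le> p" using ule CA by (auto simp: le_fun_def A_def)
        then show ?thesis by simp
      qed
      ultimately show ?thesis using ule by (auto simp: A_def P_def le_fun_def)
    qed
  qed
  then show ?thesis unfolding A_def P_def by (metis (mono_tags, lifting) mem_Collect_eq order_trans)
qed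

text \<open>
  For fixed \<open>y\<close>, the infimum over \<open>t \<ge> 0\<close> of \<open>g (x + t *\<^sub>R y) - t * g y\<close> is a sublinear function of
  \<open>x\<close> below \<open>g\<close>. By minimality it equals \<open>g\<close>, and \<open>t = 1\<close> gives superadditivity.
\<close>

lemma sublinear_minimal_linear:
  assumes g: "sublinear g" and min: "\<And>q. sublinear q \<Longrightarrow> q \<le> g \<Longrightarrow> q = g"
  shows "linear g"
proof -
  have add: "g (x + y) = g x + g y" for x y
  proof -
    define q where "q = (\<lambda>x. INF t\<in>{0..}. g (x + t *\<^sub>R y) - t * g y)"
    have sc: "g (t *\<^sub>R y) = t * g y" if "t \<ge> 0" for t
      using that sublinear_scale[OF g, of t y] sublinear_0[OF g] by (cases "t = 0") auto
    have low: "- g (- x) \<le> g (x + t *\<^sub>R y) - t * g y" if "t \<ge> 0" for x t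
      using sublinear_add[OF g, of "- x" "x + t *\<^sub>R y"] sc[OF that] by simp
    have qle: "q x \<le> g (x + t *\<^sub>R y) - t * g y" if "t \<ge> 0" for x t
      unfolding q_def using that low by (intro cINF_lower bdd_belowI2[where m="- g (- x)"]) auto
    have qge: "c \<le> q x" if "\<And>t. t \<ge> 0 \<Longrightarrow> c \<le> g (x + t *\<^sub>R y) - t * g y" for c x
      unfolding q_def using that by (intro cINF_greatest) auto
    have "sublinear q"
      unfolding sublinear_def
    proof (intro conjI allI impI)
      fix x x'
      have 1: "q (x + x') \<le> (g (x + t *\<^sub>R y) - t * g y) + (g (x' + t' *\<^sub>R y) - t' * g y)"
        if "t \<ge> 0" "t' \<ge> 0" for t t'
        using qle[of "t + t'" "x + x'"] that
          sublinear_add[OF g, of "x + t *\<^sub>R y" "x' + t' *\<^sub>R y"]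
        by (simp add: algebra_simps)
      have "q (x + x') - (g (x + t *\<^sub>R y) - t * g y) \<le> q x'" if "t \<ge> 0" for t
        by (rule qge) (use 1[OF that] in \<open>simp add: algebra_simps\<close>)
      then have "q (x + x') - q x' \<le> q x"
        by (intro qge) (simp add: algebra_simps)
      then show "q (x + x') \<le> q x + q x'" by simp
    next
      fix t :: real and x assume t: "t > 0"
      have "q (t *\<^sub>R x) / t \<le> q x"
      proof (rule qge)
        fix u :: real assume u: "u \<ge> 0"
        have "q (t *\<^sub>R x) \<le> g (t *\<^sub>R x + (t * u) *\<^sub>R y) - t * u * g y"
          using qle[of "t * u"] t u by simp
        also have "t *\<^sub>R x + (t * u) *\<^sub>R y = t *\<^sub>R (x + u *\<^sub>R y)" by (simp add: algebra_simps)
        also have "g \<dots> = t * g (x + u *\<^sub>R y)" using sublinear_scale[OF g t] .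
        finally show "q (t *\<^sub>R x) / t \<le> g (x + u *\<^sub>R y) - u * g y"
          using t by (simp add: field_simps)
      qed
      then show "q (t *\<^sub>R x) \<le> t * q x" using t by (simp add: field_simps)
    qed
    moreover have "q \<le> g" using qle[of 0] by (auto simp: le_fun_def)
    ultimately have "q = g" by (rule min)
    then have "g x \<le> g (x + y) - g y" using qle[of 1 x] by simp
    then show ?thesis using sublinear_add[OF g, of x y] by simp
  qed
  have neg: "g (- x) = - g x" for x
    using add[of x "- x"] sublinear_0[OF g] by simp
  have "g (t *\<^sub>R x) = t * g x" for t x
  proof -
    consider "t > 0" | "t = 0" | "t < 0" by linarith
    then show ?thesis
    proof cases
      case 3
      then show ?thesis using sublinear_scale[OF g, of "- t" x] neg[of "t *\<^sub>R x"] by simp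
    qed (use sublinear_scale[OF g] sublinear_0[OF g] in auto)
  qed
  with add show ?thesis by (intro linearI) auto
qed

text \<open>
  A form of the Hahn--Banach theorem: the constraints \<open>g w \<le> t\<close> for \<open>(w, t)\<close> in a convex cone
  can be met by a functional dominated by the norm if none of them contradicts this
  domination. The functional is a minimal sublinear function below the infimum of
  \<open>norm (x - w) + t\<close>.
\<close>

lemma linear_dominated_on_cone:
  fixes W :: "('a::real_normed_vector \<times> real) set"
  assumes W0: "(0, 0) \<in> W"
    and add: "\<And>w t w' t'. (w, t) \<in> W \<Longrightarrow> (w', t') \<in> W \<Longrightarrow> (w + w', t + t') \<in> W"
    and scale: "\<And>w t c. (w, t) \<in> W \<Longrightarrow> c > 0 \<Longrightarrow> (c *\<^sub>R w, c * t) \<in> W"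
    and bound: "\<And>w t. (w, t) \<in> W \<Longrightarrow> - norm w \<le> t"
  shows "\<exists>g. linear g \<and> (\<forall>x. \<bar>g x\<bar> \<le> norm x) \<and> (\<forall>(w, t)\<in>W. g w \<le> t)"
proof -
  define p where "p = (\<lambda>x. INF (w, t)\<in>W. norm (x - w) + t)"
  have low: "- norm x \<le> norm (x - w) + t" if "(w, t) \<in> W" for x w t
    using bound[OF that] norm_triangle_sub[of w x] by (simp add: norm_minus_commute)
  have ple: "p x \<le> norm (x - w) + t" if "(w, t) \<in> W" for x w t
    unfolding p_def using that low
    by (intro cINF_lower2[where x="(w, t)"] bdd_belowI2[where m="- norm x"]) auto
  have pge: "c \<le> p x" if "\<And>w t. (w, t) \<in> W \<Longrightarrow> c \<le> norm (x - w) + t" for c x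
    unfolding p_def using that W0 by (intro cINF_greatest) auto
  have "sublinear p"
    unfolding sublinear_def
  proof (intro conjI allI impI)
    fix x y
    have 1: "p (x + y) \<le> (norm (x - w) + t) + (norm (y - w') + t')"
      if "(w, t) \<in> W" "(w', t') \<in> W" for w t w' t'
      using ple[OF add[OF that], of "x + y"] norm_triangle_ineq[of "x - w" "y - w'"]
      by (simp add: algebra_simps)
    have "p (x + y) - (norm (x - w) + t) \<le> p y" if "(w, t) \<in> W" for w t
      by (rule pge) (use 1[OF that] in \<open>simp add: algebra_simps\<close>)
    then have "p (x + y) - p y \<le> p x"
      by (intro pge) (simp add: algebra_simps)
    then show "p (x + y) \<le> p x + p y" by simp
  next
    fix c :: real and x assume c: "c > 0"
    have "p (c *\<^sub>R x) / c \<le> p x"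
    proof (rule pge)
      fix w t assume W: "(w, t) \<in> W"
      have "p (c *\<^sub>R x) \<le> norm (c *\<^sub>R (x - w)) + c * t"
        using ple[OF scale[OF W c], of "c *\<^sub>R x"] by (simp add: scaleR_diff_right)
      also have "\<dots> = c * (norm (x - w) + t)" using c by (simp add: distrib_left)
      finally show "p (c *\<^sub>R x) / c \<le> norm (x - w) + t" using c by (simp add: field_simps)
    qed
    then show "p (c *\<^sub>R x) \<le> c * p x" using c by (simp add: field_simps)
  qed
  from sublinear_minimal_exists[OF this] obtain g where g: "sublinear g" "g \<le> p"
    "\<And>q. sublinear q \<Longrightarrow> q \<le> g \<Longrightarrow> q = g" by blast
  have lin: "linear g" by (rule sublinear_minimal_linear[OF g(1,3)])
  have gp: "g x \<le> p x" for x using g(2) by (auto simp: le_fun_def)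
  have "g x \<le> norm x" for x using gp[of x] ple[OF W0, of x] by simp
  from this this[of "- x" for x] have "\<bar>g x\<bar> \<le> norm x" for x
    by (simp add: abs_le_iff linear_neg[OF lin, symmetric])
  moreover have "g w \<le> t" if "(w, t) \<in> W" for w t
    using gp[of w] ple[OF that, of w] by simp
  ultimately show ?thesis using lin by blast
qed

section \<open>Oscillation of sequences and of their images under functionals\<close>

lemma diameter_tail_nonneg: "bounded (range x) \<Longrightarrow> 0 \<le> diameter (x ` A)"
  by (intro diameter_ge_0) (auto intro: bounded_subset)

lemma ca_le_diameter: "bounded (range x) \<Longrightarrow> ca x \<le> diameter (x ` {n..})"
  unfolding ca_def by (intro cINF_lower bdd_belowI2[where m=0] diameter_tail_nonneg) auto

lemma ca_nonneg: "bounded (range x) \<Longrightarrow> 0 \<le> ca x"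
  unfolding ca_def by (intro cINF_greatest diameter_tail_nonneg) auto

lemma ca_geI:
  assumes "bounded (range x)" and "\<And>n. \<exists>k\<ge>n. \<exists>l\<ge>n. d \<le> dist (x k) (x l)"
  shows "d \<le> ca x"
  unfolding ca_def
proof (rule cINF_greatest)
  fix n
  obtain k l where kl: "k \<ge> n" "l \<ge> n" "d \<le> dist (x k) (x l)" using assms(2) by blast
  have "bounded (x ` {n..})" using assms(1) by (rule bounded_subset) auto
  from diameter_bounded_bound[OF this, of "x k" "x l"] kl show "d \<le> diameter (x ` {n..})" by auto
qed simp

lemma ca_leI:
  fixes x :: "nat \<Rightarrow> 'a::real_normed_vector"
  assumes "bounded (range x)" and "\<And>k l. k \<ge> n \<Longrightarrow> l \<ge> n \<Longrightarrow> dist (x k) (x l) \<le> d"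
  shows "ca x \<le> d"
proof -
  have "diameter (x ` {n..}) \<le> d"
    by (rule diameter_le) (use assms(2) in \<open>auto simp: dist_norm\<close>)
  then show ?thesis using ca_le_diameter[OF assms(1), of n] by simp
qed

lemma bounded_range_subseq: "bounded (range x) \<Longrightarrow> bounded (range (x \<circ> r))"
  by (rule bounded_subset) auto

lemma ca_tilde_le_ca:
  assumes "bounded (range x)" "strict_mono r"
  shows "ca_tilde x \<le> ca (x \<circ> r)"
  unfolding ca_tilde_def
  by (intro cINF_lower bdd_belowI2[where m=0] ca_nonneg bounded_range_subseq) (use assms in auto)

lemma ca_tilde_geI:
  assumes "\<And>r. strict_mono r \<Longrightarrow> d \<le> ca (x \<circ> r)"
  shows "d \<le> ca_tilde x"
  unfolding ca_tilde_def by (rule cINF_greatest) (use assms strict_mono_id in auto)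

lemma ca_tilde_mono_subseq:
  assumes "bounded (range x)" "strict_mono r"
  shows "ca_tilde x \<le> ca_tilde (x \<circ> r)"
proof (rule ca_tilde_geI)
  fix r' :: "nat \<Rightarrow> nat" assume "strict_mono r'"
  then show "ca_tilde x \<le> ca (x \<circ> r \<circ> r')"
    using ca_tilde_le_ca[OF assms(1), of "r \<circ> r'"] assms(2) by (simp add: strict_mono_o comp_assoc)
qed

lemma dual_ball_norm_le: "f \<in> dual_ball s \<Longrightarrow> norm (f v) \<le> norm v"
  unfolding dual_ball_def using onorm[of f v] mult_right_mono[of "onorm f" 1 "norm v"] by simp

lemma bounded_range_dual:
  assumes "bounded (range x)" "f \<in> dual_ball s"
  shows "bounded (range (\<lambda>n. f (x n)))"
proof -
  have "bounded (f ` range x)"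
    using assms by (intro bounded_linear_image) (auto simp: dual_ball_def)
  then show ?thesis by (simp add: image_image)
qed

lemma ca_dual_le_delta:
  assumes x: "bounded (range x)" and f: "f \<in> dual_ball s"
  shows "ca (\<lambda>n. f (x n)) \<le> delta s x"
proof -
  obtain B where B: "\<And>n. norm (x n) \<le> B" using x by (auto simp: bounded_iff)
  have "ca (\<lambda>n. h (x n)) \<le> 2 * B" if h: "h \<in> dual_ball s" for h
  proof (rule ca_leI[OF bounded_range_dual[OF x h]])
    fix k l
    have "dist (h (x k)) (h (x l)) \<le> norm (h (x k)) + norm (h (x l))"
      by (simp add: dist_norm norm_triangle_ineq4)
    then show "dist (h (x k)) (h (x l)) \<le> 2 * B"
      using dual_ball_norm_le[OF h] B order_trans[of "norm (h (x k))" "norm (x k)" B]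
        order_trans[of "norm (h (x l))" "norm (x l)" B] by fastforce
  qed
  then show ?thesis unfolding delta_def using f by (intro cSUP_upper bdd_aboveI2) auto
qed

lemma zero_in_dual_ball: "(\<lambda>_. 0) \<in> dual_ball s"
  by (simp add: dual_ball_def onorm_zero)

lemma delta_nonneg:
  assumes "bounded (range x)"
  shows "0 \<le> delta s x"
  using ca_nonneg[OF bounded_range_dual[OF assms zero_in_dual_ball[of s]]]
    ca_dual_le_delta[OF assms zero_in_dual_ball[of s]] by (rule order_trans)

lemma delta_tilde_le_delta:
  assumes "bounded (range x)" "strict_mono r"
  shows "delta_tilde s x \<le> delta s (x \<circ> r)"
  unfolding delta_tilde_def
  by (intro cINF_lower bdd_belowI2[where m=0] delta_nonneg bounded_range_subseq) (use assms in auto)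

lemma delta_tilde_geI:
  assumes "\<And>r. strict_mono r \<Longrightarrow> d \<le> delta s (x \<circ> r)"
  shows "d \<le> delta_tilde s x"
  unfolding delta_tilde_def by (rule cINF_greatest) (use assms strict_mono_id in auto)

lemma less_deltaD:
  assumes "d < delta s x"
  shows "\<exists>f\<in>dual_ball s. d < ca (\<lambda>n. f (x n))"
proof (rule ccontr)
  assume "\<not> ?thesis"
  then have "delta s x \<le> d" unfolding delta_def
    using zero_in_dual_ball by (intro cSUP_least) (auto simp: not_less)
  with assms show False by simp
qed

lemma ca_subseq_le:
  assumes "bounded (range x)" "strict_mono r"
  shows "ca (x \<circ> r) \<le> ca x"
  unfolding ca_def[of x]
proof (rule cINF_greatest)
  fix n
  have "(x \<circ> r) ` {n..} \<subseteq> x ` {n..}"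
    using strict_mono_imp_increasing[OF assms(2)] order_trans by fastforce
  moreover have "bounded (x ` {n..})" using assms(1) by (rule bounded_subset) auto
  ultimately have "diameter ((x \<circ> r) ` {n..}) \<le> diameter (x ` {n..})" by (rule diameter_subset)
  with ca_le_diameter[OF bounded_range_subseq[OF assms(1), of r], of n]
  show "ca (x \<circ> r) \<le> diameter (x ` {n..})" by (rule order_trans)
qed simp

lemma delta_subseq_le:
  assumes x: "bounded (range x)" and r: "strict_mono r"
  shows "delta s (x \<circ> r) \<le> delta s x"
  unfolding delta_def[of s "x \<circ> r"]
proof (rule cSUP_least)
  fix f assume f: "f \<in> dual_ball s"
  have "ca ((\<lambda>n. f (x n)) \<circ> r) \<le> ca (\<lambda>n. f (x n))"
    by (rule ca_subseq_le[OF bounded_range_dual[OF x f] r])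
  with ca_dual_le_delta[OF x f] show "ca (\<lambda>n. f ((x \<circ> r) n)) \<le> delta s x" by (simp add: o_def)
qed (use zero_in_dual_ball in auto)

section \<open>Subsequences with a lower \<open>\<ell>\<^sub>1\<close>-estimate\<close>

text \<open>
  Both cluster values of an oscillating functional can be approximated within a finite net \<open>T\<close>.
  They then belong to a finite set of pairs that depends only on \<open>d\<close>, \<open>e\<close> and \<open>T\<close>.
\<close>

lemma oscillating_functional:
  fixes s :: "'k::{real_normed_field,heine_borel} \<Rightarrow> 'a::real_normed_vector \<Rightarrow> 'a"
  assumes x: "bounded (range x)" and e: "e > 0"
    and T: "finite T" "\<And>f n. f \<in> dual_ball s \<Longrightarrow> \<exists>t\<in>T. dist t (f (x n)) < e"
    and osc: "\<And>r. strict_mono r \<Longrightarrow> \<exists>f\<in>dual_ball s. d < ca (\<lambda>n. f (x (r n)))"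
    and N: "infinite N"
  shows "\<exists>f\<in>dual_ball s. \<exists>p\<in>{p \<in> T \<times> T. d - 2 * e < dist (fst p) (snd p)}.
           oscillates (\<lambda>b n. {f. dist (if b then fst p else snd p) (f (x n)) < e}) f N"
proof -
  define r where "r = enumerate N"
  have r: "strict_mono r" unfolding r_def using N by (rule strict_mono_enumerate)
  have rN: "r n \<in> N" for n unfolding r_def using N by (rule enumerate_in_set)
  from osc[OF r] obtain f where f: "f \<in> dual_ball s" "d < ca (\<lambda>n. f (x (r n)))" by blast
  define Q where "Q = {p \<in> T \<times> T. d - 2 * e < dist (fst p) (snd p)}"
  define R where "R = (\<lambda>n p. \<exists>k\<ge>n. \<exists>l\<ge>n. dist (fst p) (f (x (r k))) < e \<and>
      dist (snd p) (f (x (r l))) < e)"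
  have "\<exists>p\<in>Q. R n p" for n
  proof -
    have "bounded (range (\<lambda>n. f (x (r n))))"
      using bounded_range_dual[OF bounded_range_subseq[OF x, of r] f(1)] by (simp add: o_def)
    then obtain k l where kl: "k \<ge> n" "l \<ge> n" "d < dist (f (x (r k))) (f (x (r l)))"
      using ca_leI[of "\<lambda>n. f (x (r n))" n d] f(2) by (meson not_less)
    obtain z w where zw: "z \<in> T" "w \<in> T" "dist z (f (x (r k))) < e" "dist w (f (x (r l))) < e"
      using T(2)[OF f(1)] by blast
    have "dist (f (x (r k))) (f (x (r l))) \<le> dist z (f (x (r k))) + dist z w + dist w (f (x (r l)))"
      using dist_triangle[of "f (x (r k))" "f (x (r l))" z] dist_triangle[of z "f (x (r l))" w]
      by (simp add: dist_commute)
    then have "(z, w) \<in> Q" using zw kl by (simp add: Q_def)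
    moreover have "R n (z, w)" unfolding R_def using kl zw by auto
    ultimately show ?thesis by blast
  qed
  moreover have "finite Q" unfolding Q_def using T(1) by simp
  ultimately obtain p where p: "p \<in> Q" "infinite {n\<in>UNIV. R n p}"
    using pigeonhole_infinite_rel[of UNIV Q R] by auto
  have "infinite {n\<in>N. dist (if b then fst p else snd p) (f (x n)) < e}" for b
    unfolding infinite_nat_iff_unbounded_le
  proof
    fix m
    obtain n where n: "n \<ge> m" "R n p" using p(2) unfolding infinite_nat_iff_unbounded_le by auto
    then obtain k l where kl: "k \<ge> n" "l \<ge> n" "dist (fst p) (f (x (r k))) < e"
      "dist (snd p) (f (x (r l))) < e" unfolding R_def by blast
    have "r k \<ge> m" "r l \<ge> m" using n kl strict_mono_imp_increasing[OF r] order_trans by meson+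
    then show "\<exists>n\<ge>m. n \<in> {n\<in>N. dist (if b then fst p else snd p) (f (x n)) < e}"
      using kl rN by (intro exI[of _ "if b then r k else r l"]) auto
  qed
  then have "oscillates (\<lambda>b n. {f. dist (if b then fst p else snd p) (f (x n)) < e}) f N"
    unfolding oscillates_def mem_Collect_eq ..
  with f(1) p(1) show ?thesis unfolding Q_def by blast
qed

text \<open>
  The quantitative form of Rosenthal's theorem, for real and complex scalars alike, with an
  arbitrary choice of signs. The norm on the left-hand side is applied to a scalar.
\<close>

lemma l1_lower_estimate_subsequence:
  fixes s :: "'k::{real_normed_field,heine_borel} \<Rightarrow> 'a::real_normed_vector \<Rightarrow> 'a"
  assumes x: "bounded (range x)" and \<eta>: "\<eta> > 0"
    and osc: "\<And>r. strict_mono r \<Longrightarrow> \<exists>f\<in>dual_ball s. d < ca (\<lambda>n. f (x (r n)))"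
  shows "\<exists>r::nat \<Rightarrow> nat. strict_mono r \<and> (\<forall>m \<alpha> \<sigma>. (\<forall>j. \<sigma> j \<in> {1, - 1}) \<longrightarrow>
     d / 2 * norm (\<Sum>j<m. \<sigma> j * \<alpha> j) - \<eta> * (\<Sum>j<m. norm (\<alpha> j))
       \<le> norm (\<Sum>j<m. s (\<alpha> j) (x (r j))))"
proof -
  define e where "e = \<eta> / 2"
  have e: "e > 0" using \<eta> by (simp add: e_def)
  obtain B where B: "\<And>n. norm (x n) \<le> B" using x by (auto simp: bounded_iff)
  have "\<exists>T\<subseteq>cball (0::'k) B. finite T \<and> cball 0 B \<subseteq> (\<Union>t\<in>T. ball t e)"
  proof (rule compactE_image[OF compact_cball[of "0::'k" B], of "cball 0 B" "\<lambda>t. ball t e"])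
    show "cball (0::'k) B \<subseteq> (\<Union>t\<in>cball 0 B. ball t e)" using e by auto
  qed auto
  then obtain T :: "'k set" where T: "finite T" "cball 0 B \<subseteq> (\<Union>t\<in>T. ball t e)" by blast
  have near: "\<exists>t\<in>T. dist t (f (x n)) < e" if "f \<in> dual_ball s" for f n
  proof -
    have "f (x n) \<in> cball 0 B" using dual_ball_norm_le[OF that, of "x n"] B[of n] by simp
    then have "f (x n) \<in> (\<Union>t\<in>T. ball t e)" using T(2) by blast
    then show ?thesis by auto
  qed
  define Q where "Q = {p \<in> T \<times> T. d - 2 * e < dist (fst p) (snd p)}"
  define C where "C = (\<lambda>p b n. {f :: 'a \<Rightarrow> 'k. dist (if b then fst p else snd p) (f (x n)) < e})"
  have "\<exists>f\<in>dual_ball s. \<exists>p\<in>Q. oscillates (C p) f N" if "infinite N" for N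
    unfolding Q_def C_def using near osc that by (intro oscillating_functional[OF x e T(1)])
  moreover have "finite Q" unfolding Q_def using T(1) by simp
  ultimately obtain p M where p: "p \<in> Q" and M: "infinite M" "hereditarily_oscillating (C p) {dual_ball s} M"
    using hereditarily_oscillating_for_one_of_finitely_many[of Q "dual_ball s" C] by blast
  obtain r :: "nat \<Rightarrow> nat" where r: "strict_mono r" "\<And>m \<sigma>. \<exists>f\<in>dual_ball s. \<forall>j<m. f \<in> C p (\<sigma> j) (r j)"
    using independent_subsequence[OF M] by blast
  obtain z w where zw: "p = (z, w)" by (cases p)
  have "d / 2 * norm (\<Sum>j<m. \<sigma> j * \<alpha> j) - \<eta> * (\<Sum>j<m. norm (\<alpha> j))
       \<le> norm (\<Sum>j<m. s (\<alpha> j) (x (r j)))"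
    if \<sigma>: "\<forall>j. \<sigma> j \<in> {1, - 1}" for m \<alpha> \<sigma>
  proof -
    define v where "v = (\<Sum>j<m. s (\<alpha> j) (x (r j)))"
    define A where "A = (\<Sum>j<m. norm (\<alpha> j))"
    \<comment> \<open>The functionals \<open>f\<close> and \<open>g\<close> realize complementary patterns of the values \<open>z\<close> and \<open>w\<close>.\<close>
    obtain f where f: "f \<in> dual_ball s" "\<And>j. j < m \<Longrightarrow> f \<in> C p (\<sigma> j = 1) (r j)"
      using r(2)[of m "\<lambda>j. \<sigma> j = 1"] by auto
    obtain g where g: "g \<in> dual_ball s" "\<And>j. j < m \<Longrightarrow> g \<in> C p (\<sigma> j \<noteq> 1) (r j)"
      using r(2)[of m "\<lambda>j. \<sigma> j \<noteq> 1"] by auto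
    have expand: "h v = (\<Sum>j<m. \<alpha> j * h (x (r j)))" if "h \<in> dual_ball s" for h
    proof -
      have lin: "linear h" and hom: "\<And>a u. h (s a u) = a * h u"
        using that by (auto simp: dual_ball_def bounded_linear.linear)
      show ?thesis by (simp add: v_def linear_sum[OF lin] hom)
    qed
    have close: "norm (\<sigma> j * (z - w) - (f (x (r j)) - g (x (r j)))) \<le> 2 * e" if j: "j < m" for j
    proof -
      define a where "a = f (x (r j))"
      define b where "b = g (x (r j))"
      have "(1::'k) \<noteq> - 1" by simp
      then consider "\<sigma> j = 1" "dist z a < e" "dist w b < e" | "\<sigma> j = - 1" "dist w a < e" "dist z b < e"
        using f(2)[OF j] g(2)[OF j] \<sigma>[rule_format, of j]
        by (auto simp: C_def zw a_def b_def)
      then have "norm (\<sigma> j * (z - w) - (a - b)) \<le> 2 * e"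
      proof cases
        case 1
        have "\<sigma> j * (z - w) - (a - b) = (z - a) - (w - b)" using 1 by simp
        then have "norm (\<sigma> j * (z - w) - (a - b)) \<le> dist z a + dist w b"
          by (metis dist_norm norm_triangle_ineq4)
        with 1 show ?thesis by simp
      next
        case 2
        have "\<sigma> j * (z - w) - (a - b) = (w - a) - (z - b)" using 2 by simp
        then have "norm (\<sigma> j * (z - w) - (a - b)) \<le> dist w a + dist z b"
          by (metis dist_norm norm_triangle_ineq4)
        with 2 show ?thesis by simp
      qed
      then show ?thesis by (simp add: a_def b_def)
    qed
    define \<Sigma> where "\<Sigma> = (\<Sum>j<m. \<sigma> j * \<alpha> j)"
    have "(z - w) * \<Sigma> - (f v - g v)
        = (\<Sum>j<m. (z - w) * (\<sigma> j * \<alpha> j) - (\<alpha> j * f (x (r j)) - \<alpha> j * g (x (r j))))"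
      unfolding expand[OF f(1)] expand[OF g(1)] \<Sigma>_def by (simp only: sum_distrib_left sum_subtractf)
    also have "\<dots> = (\<Sum>j<m. \<alpha> j * (\<sigma> j * (z - w) - (f (x (r j)) - g (x (r j)))))"
      by (rule sum.cong) (simp_all add: algebra_simps)
    also have "norm \<dots> \<le> (\<Sum>j<m. norm (\<alpha> j) * (2 * e))"
    proof (rule sum_norm_le)
      fix j assume "j \<in> {..<m}"
      then show "norm (\<alpha> j * (\<sigma> j * (z - w) - (f (x (r j)) - g (x (r j))))) \<le> norm (\<alpha> j) * (2 * e)"
        unfolding norm_mult[of "\<alpha> j"] by (intro mult_left_mono close) auto
    qed
    also have "\<dots> = A * (2 * e)" unfolding A_def by (rule sum_distrib_right[symmetric])
    finally have err: "norm ((z - w) * \<Sigma> - (f v - g v)) \<le> A * (2 * e)" .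
    have "norm (z - w) * norm \<Sigma> - norm (f v - g v) \<le> norm ((z - w) * \<Sigma> - (f v - g v))"
      unfolding norm_mult[symmetric] by (rule norm_triangle_ineq2)
    moreover have "norm (f v - g v) \<le> 2 * norm v"
      using norm_triangle_ineq4[of "f v" "g v"] dual_ball_norm_le[OF f(1), of v]
        dual_ball_norm_le[OF g(1), of v] by linarith
    moreover have "(d - 2 * e) * norm \<Sigma> \<le> norm (z - w) * norm \<Sigma>"
      using p by (intro mult_right_mono) (auto simp: Q_def zw dist_norm)
    moreover have "norm \<Sigma> \<le> A"
      unfolding A_def \<Sigma>_def
    proof (rule sum_norm_le)
      fix j
      have "norm (\<sigma> j) = 1" using \<sigma>[rule_format, of j] by auto
      then show "norm (\<sigma> j * \<alpha> j) \<le> norm (\<alpha> j)" by (simp add: norm_mult)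
    qed
    then have "norm \<Sigma> * (2 * e) \<le> A * (2 * e)" using e by (intro mult_right_mono) auto
    moreover have "(d - 2 * e) * norm \<Sigma> = d * norm \<Sigma> - norm \<Sigma> * (2 * e)" by (simp add: algebra_simps)
    moreover have "\<eta> * A = A * (2 * e)" by (simp add: e_def)
    ultimately have "d / 2 * norm \<Sigma> - \<eta> * A \<le> norm v" using err by linarith
    then show ?thesis unfolding v_def A_def \<Sigma>_def .
  qed
  then show ?thesis using r(1) by blast
qed

text \<open>
  Here \<open>\<kappa>\<close> is the fraction of the \<open>\<ell>\<^sub>1\<close>-norm of the coefficients that a suitable choice of signs
  recovers.
\<close>

lemma property_iv_imp_vi:
  fixes s :: "'k::{real_normed_field,heine_borel} \<Rightarrow> 'a::real_normed_vector \<Rightarrow> 'a"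
  assumes \<kappa>: "\<kappa> > 0" and c: "c > 0"
    and signs: "\<And>(m::nat) (\<alpha>::nat \<Rightarrow> 'k). \<exists>\<sigma>. (\<forall>j. \<sigma> j \<in> {1, - 1}) \<and>
        \<kappa> * (\<Sum>j<m. norm (\<alpha> j)) \<le> norm (\<Sum>j<m. \<sigma> j * \<alpha> j)"
    and iv: "property_iv s c"
  shows "property_vi s (c / \<kappa>)"
  unfolding property_vi_def
proof (intro ballI allI impI)
  fix \<delta> \<epsilon> :: real and x :: "nat \<Rightarrow> 'a"
  assume "\<delta> \<in> {0<..2}" and \<epsilon>: "0 < \<epsilon>" and "normalized x \<and> separated \<delta> x"
  then have \<delta>: "\<delta> > 0" and nrm: "\<And>n. norm (x n) = 1"
    and sep: "\<And>n m. n \<noteq> m \<Longrightarrow> \<delta> \<le> norm (x n - x m)"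
    by (auto simp: normalized_def separated_def)
  define L where "L = 1 / (2 * (c / \<kappa>) / \<delta> + \<epsilon>)"
  define L' where "L' = \<kappa> * \<delta> / (2 * c)"
  have pos: "2 * (c / \<kappa>) / \<delta> > 0" using \<kappa> \<delta> c by simp
  have "L' = 1 / (2 * (c / \<kappa>) / \<delta>)" using \<kappa> \<delta> c by (simp add: L'_def field_simps)
  also have "\<dots> > L" unfolding L_def
    by (rule divide_strict_left_mono) (use pos \<epsilon> in \<open>auto simp del: times_divide_eq_right\<close>)
  finally have LL: "L < L'" "L > 0" unfolding L_def using \<epsilon> pos by (auto intro: add_pos_pos)
  \<comment> \<open>The choice makes \<open>\<kappa> * d / 2 - \<eta>\<close> equal to \<open>L\<close>, while \<open>d < \<delta> / c\<close> because \<open>L < L'\<close>.\<close>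
  define \<eta> where "\<eta> = (L' - L) / 2"
  define d where "d = 2 * (L + \<eta>) / \<kappa>"
  have \<eta>: "\<eta> > 0" using LL by (simp add: \<eta>_def)
  have d: "d > 0" "d * \<kappa> / 2 = L + \<eta>" using LL \<eta> \<kappa> by (simp_all add: d_def)
  have "L + \<eta> < L'" using LL by (simp add: \<eta>_def field_simps)
  then have "c * d < \<delta>" using \<kappa> c unfolding d_def L'_def by (simp add: field_simps)
  have bx: "bounded (range x)" using nrm by (auto simp: bounded_iff)
  have "\<delta> \<le> ca_tilde x"
  proof (rule ca_tilde_geI)
    fix r :: "nat \<Rightarrow> nat" assume r: "strict_mono r"
    show "\<delta> \<le> ca (x \<circ> r)"
    proof (rule ca_geI[OF bounded_range_subseq[OF bx]])
      fix n
      have "r n \<noteq> r (Suc n)" using r by (simp add: strict_mono_eq)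
      then show "\<exists>k\<ge>n. \<exists>l\<ge>n. \<delta> \<le> dist ((x \<circ> r) k) ((x \<circ> r) l)"
        using sep by (intro exI[of _ n] conjI exI[of _ "Suc n"]) (auto simp: dist_norm)
    qed
  qed
  also have "\<dots> \<le> c * delta_tilde s x" using iv bx by (simp add: property_iv_def)
  finally have "c * d < c * delta_tilde s x" using \<open>c * d < \<delta>\<close> by simp
  then have dt: "d < delta_tilde s x" using c by simp
  have "\<exists>f\<in>dual_ball s. d < ca (\<lambda>n. f (x (r n)))" if "strict_mono r" for r
    using less_deltaD[of d s "x \<circ> r"] delta_tilde_le_delta[OF bx that, of s] dt by simp
  then have "\<exists>r::nat \<Rightarrow> nat. strict_mono r \<and> (\<forall>m \<alpha> \<sigma>. (\<forall>j. \<sigma> j \<in> {1, - 1}) \<longrightarrow>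
     d / 2 * norm (\<Sum>j<m. \<sigma> j * \<alpha> j) - \<eta> * (\<Sum>j<m. norm (\<alpha> j))
       \<le> norm (\<Sum>j<m. s (\<alpha> j) (x (r j))))"
    by (rule l1_lower_estimate_subsequence[OF bx \<eta>])
  then obtain r :: "nat \<Rightarrow> nat" where r: "strict_mono r"
    and est: "\<And>m \<alpha> \<sigma>. (\<forall>j. \<sigma> j \<in> {1, - 1}) \<Longrightarrow>
     d / 2 * norm (\<Sum>j<m. \<sigma> j * \<alpha> j) - \<eta> * (\<Sum>j<m. norm (\<alpha> j))
       \<le> norm (\<Sum>j<m. s (\<alpha> j) (x (r j)))" by blast
  have "L * (\<Sum>j<m. norm (\<alpha> j)) \<le> norm (\<Sum>j<m. s (\<alpha> j) (x (r j)))" for m \<alpha>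
  proof -
    obtain \<sigma> where \<sigma>: "\<forall>j. \<sigma> j \<in> {1, - 1}"
      "\<kappa> * (\<Sum>j<m. norm (\<alpha> j)) \<le> norm (\<Sum>j<m. \<sigma> j * \<alpha> j)" using signs by blast
    have "d / 2 * (\<kappa> * (\<Sum>j<m. norm (\<alpha> j))) \<le> d / 2 * norm (\<Sum>j<m. \<sigma> j * \<alpha> j)"
      using \<sigma>(2) d(1) by (intro mult_left_mono) auto
    also have "d / 2 * (\<kappa> * (\<Sum>j<m. norm (\<alpha> j))) = (L + \<eta>) * (\<Sum>j<m. norm (\<alpha> j))"
      by (simp add: d(2)[symmetric])
    finally show ?thesis using est[OF \<sigma>(1), where m=m and \<alpha>=\<alpha>] by (simp add: algebra_simps)
  qed
  then show "\<exists>r. strict_mono r \<and> equivalent_l1_basis s (2 * (c / \<kappa>) / \<delta> + \<epsilon>) (x \<circ> r)"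
    using r nrm by (auto simp: equivalent_l1_basis_def normalized_def L_def)
qed

section \<open>Functionals with alternating values on an \<open>\<ell>\<^sub>1\<close>-sequence\<close>

text \<open>
  The prescribed values define a functional on the real span of all \<open>s a (y j)\<close>. The cone consists
  of the graph of this functional; it is stated with finitely supported coefficient
  sequences, so that sums of different lengths can be added.
\<close>

lemma real_functional_with_values:
  fixes s :: "'k::real_normed_field \<Rightarrow> 'a::real_normed_vector \<Rightarrow> 'a"
    and y :: "nat \<Rightarrow> 'a" and h :: "nat \<Rightarrow> 'k \<Rightarrow> real"
  assumes add: "\<And>a b u. s (a + b) u = s a u + s b u"
    and scale: "\<And>t a u. s (t *\<^sub>R a) u = t *\<^sub>R s a u"
    and h: "\<And>j. linear (h j)" "\<And>j a. \<bar>h j a\<bar> \<le> L * norm a"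
    and low: "\<And>m \<alpha>. L * (\<Sum>j<m. norm (\<alpha> j)) \<le> norm (\<Sum>j<m. s (\<alpha> j) (y j))"
  shows "\<exists>g. linear g \<and> (\<forall>u. \<bar>g u\<bar> \<le> norm u) \<and> (\<forall>j a. g (s a (y j)) = h j a)"
proof -
  have s0: "s 0 u = 0" for u using scale[of 0 0 u] by simp
  define V where "V = (\<lambda>m \<alpha>. \<Sum>j<m. s (\<alpha> j) (y j))"
  define H where "H = (\<lambda>m \<alpha>. \<Sum>j<m. h j (\<alpha> j))"
  define W where "W = {(V m \<alpha>, H m \<alpha>) | m \<alpha>. \<forall>j\<ge>m. \<alpha> j = 0}"
  have h0: "h j 0 = 0" for j using h(1) by (rule linear_0)
  have extend: "V m \<alpha> = V n \<alpha>" "H m \<alpha> = H n \<alpha>" if "\<forall>j\<ge>m. \<alpha> j = 0" "m \<le> n" for m n \<alpha>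
  proof -
    have "\<alpha> j = 0" if "j \<in> {..<n} - {..<m}" for j
      using that \<open>\<forall>j\<ge>m. \<alpha> j = 0\<close> by simp
    then show "V m \<alpha> = V n \<alpha>" "H m \<alpha> = H n \<alpha>"
      unfolding V_def H_def using \<open>m \<le> n\<close>
      by (simp_all add: s0 h0 sum.mono_neutral_left[of "{..<n}" "{..<m}"])
  qed
  have "\<exists>g. linear g \<and> (\<forall>u. \<bar>g u\<bar> \<le> norm u) \<and> (\<forall>(w, t)\<in>W. g w \<le> t)"
  proof (rule linear_dominated_on_cone)
    show "(0, 0) \<in> W"
      unfolding W_def V_def H_def by (rule CollectI, rule exI[of _ 0], rule exI[of _ "\<lambda>_. 0"]) simp
  next
    fix w t w' t' assume "(w, t) \<in> W" "(w', t') \<in> W"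
    then obtain m \<alpha> m' \<beta> where *: "w = V m \<alpha>" "t = H m \<alpha>" "\<forall>j\<ge>m. \<alpha> j = 0"
      "w' = V m' \<beta>" "t' = H m' \<beta>" "\<forall>j\<ge>m'. \<beta> j = 0" unfolding W_def by blast
    define n where "n = max m m'"
    have "w = V n \<alpha>" "t = H n \<alpha>" "w' = V n \<beta>" "t' = H n \<beta>"
      unfolding * n_def by (rule extend; use * in simp)+
    then have "w + w' = V n (\<lambda>j. \<alpha> j + \<beta> j)" "t + t' = H n (\<lambda>j. \<alpha> j + \<beta> j)"
      by (simp_all add: V_def H_def add sum.distrib linear_add[OF h(1)])
    moreover have "\<forall>j\<ge>n. \<alpha> j + \<beta> j = 0" using * by (simp add: n_def)
    ultimately show "(w + w', t + t') \<in> W" unfolding W_def by blast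
  next
    fix w t and c :: real assume "(w, t) \<in> W" "c > 0"
    then obtain m \<alpha> where *: "w = V m \<alpha>" "t = H m \<alpha>" "\<forall>j\<ge>m. \<alpha> j = 0" unfolding W_def by blast
    then have "c *\<^sub>R w = V m (\<lambda>j. c *\<^sub>R \<alpha> j)" "c * t = H m (\<lambda>j. c *\<^sub>R \<alpha> j)"
      by (simp_all add: V_def H_def scale scaleR_sum_right sum_distrib_left linear_cmul[OF h(1)])
    moreover have "\<forall>j\<ge>m. c *\<^sub>R \<alpha> j = 0" using * by simp
    ultimately show "(c *\<^sub>R w, c * t) \<in> W" unfolding W_def by blast
  next
    fix w t assume "(w, t) \<in> W"
    then obtain m \<alpha> where *: "w = V m \<alpha>" "t = H m \<alpha>" unfolding W_def by blast
    have "\<bar>t\<bar> \<le> (\<Sum>j<m. L * norm (\<alpha> j))"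
      unfolding * H_def by (rule order_trans[OF sum_abs]) (intro sum_mono h(2))
    also have "\<dots> \<le> norm w" using low[where m=m and \<alpha>=\<alpha>] by (simp add: * V_def sum_distrib_left)
    finally show "- norm w \<le> t" by simp
  qed
  then obtain g where g: "linear g" "\<And>u. \<bar>g u\<bar> \<le> norm u" "\<And>w t. (w, t) \<in> W \<Longrightarrow> g w \<le> t"
    by blast
  have le: "g (s a (y j)) \<le> h j a" for j a
  proof (rule g(3))
    have "V (Suc j) (\<lambda>i. if i = j then a else 0) = s a (y j)"
      "H (Suc j) (\<lambda>i. if i = j then a else 0) = h j a"
      by (simp_all add: V_def H_def s0 h0)
    then show "(s a (y j), h j a) \<in> W" unfolding W_def mem_Collect_eq
      by (intro exI[of _ "Suc j"] exI[of _ "\<lambda>i. if i = j then a else 0"]) simp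
  qed
  have "g (s a (y j)) = h j a" for j a
  proof (rule antisym[OF le])
    have "s (- a) (y j) = - s a (y j)" using scale[of "- 1" a "y j"] by simp
    then show "h j a \<le> g (s a (y j))"
      using le[of "- a" j] by (simp add: linear_neg[OF g(1)] linear_neg[OF h(1)])
  qed
  with g show ?thesis by blast
qed

lemma alternating_functional_real:
  fixes y :: "nat \<Rightarrow> 'a::real_normed_vector"
  assumes L: "L \<ge> 0"
    and low: "\<And>m \<alpha>. L * (\<Sum>j<m. norm (\<alpha> j)) \<le> norm (\<Sum>j<m. \<alpha> j *\<^sub>R y j)"
  shows "\<exists>f\<in>dual_ball (scaleR :: real \<Rightarrow> 'a \<Rightarrow> 'a). \<forall>j. f (y j) = (- 1) ^ j * of_real L"
proof -
  have "\<exists>g. linear g \<and> (\<forall>u. \<bar>g u\<bar> \<le> norm u) \<and> (\<forall>j a. g (a *\<^sub>R y j) = (- 1) ^ j * L * a)"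
    by (rule real_functional_with_values[OF _ _ _ _ low])
       (use L in \<open>auto simp: scaleR_add_left abs_mult intro!: linearI simp: algebra_simps\<close>)
  then obtain g where g: "linear g" "\<And>u. \<bar>g u\<bar> \<le> norm u" "\<And>j a. g (a *\<^sub>R y j) = (- 1) ^ j * L * a"
    by blast
  have "bounded_linear g"
    using g(2) by (intro bounded_linear_intro[where K=1])
      (auto simp: linear_add[OF g(1)] linear_cmul[OF g(1)])
  moreover have "onorm g \<le> 1" by (rule onorm_bound) (use g(2) in simp_all)
  ultimately have "g \<in> dual_ball scaleR" by (simp add: dual_ball_def linear_cmul[OF g(1)])
  moreover have "g (y j) = (- 1) ^ j * of_real L" for j using g(3)[of 1 j] by simp
  ultimately show ?thesis by blast
qed

text \<open>
  A complex functional is determined by its real part \<open>g\<close> as \<open>g u - \<i> * g (\<i> u)\<close>, and it has the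
  same norm. The values of \<open>g\<close> are prescribed at all complex multiples of the vectors \<open>y j\<close>, which
  makes the imaginary part vanish at \<open>y j\<close>.
\<close>

lemma alternating_functional_complex:
  fixes y :: "nat \<Rightarrow> 'b::complex_normed_vector"
  assumes L: "L \<ge> 0"
    and low: "\<And>m \<alpha>. L * (\<Sum>j<m. norm (\<alpha> j)) \<le> norm (\<Sum>j<m. scaleC (\<alpha> j) (y j))"
  shows "\<exists>f\<in>dual_ball (scaleC :: complex \<Rightarrow> 'b \<Rightarrow> 'b). \<forall>j. f (y j) = (- 1) ^ j * of_real L"
proof -
  have sR: "scaleC (t *\<^sub>R a) u = t *\<^sub>R scaleC a u" for t a and u :: 'b
    by (simp add: scaleC_of_real[symmetric] scaleC_scaleC scaleR_conv_of_real)
  have comm: "scaleC a (t *\<^sub>R u) = t *\<^sub>R scaleC a u" for t a and u :: 'b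
    by (simp add: scaleC_of_real[symmetric] scaleC_scaleC mult.commute)
  have one: "scaleC 1 u = u" and neg_one: "scaleC (- 1) u = - u" for u :: 'b
    using scaleC_of_real[of 1 u] scaleC_of_real[of "- 1" u] by simp_all
  have "\<exists>g. linear g \<and> (\<forall>u. \<bar>g u\<bar> \<le> norm u) \<and>
      (\<forall>j a. g (scaleC a (y j)) = (- 1) ^ j * L * Re a)"
    by (rule real_functional_with_values[OF _ _ _ _ low])
       (use L abs_Re_le_cmod in \<open>auto simp: sR scaleC_add_left abs_mult algebra_simps
          intro!: linearI mult_left_mono\<close>)
  then obtain g where g: "linear g" "\<And>u. \<bar>g u\<bar> \<le> norm u"
    "\<And>j a. g (scaleC a (y j)) = (- 1) ^ j * L * Re a" by blast
  define f where "f = (\<lambda>u. Complex (g u) (- g (scaleC \<i> u)))"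
  have f_add: "f (u + v) = f u + f v" for u v
    by (simp add: f_def scaleC_add_right linear_add[OF g(1)] complex_eq_iff)
  have f_scaleR: "f (t *\<^sub>R u) = t *\<^sub>R f u" for t u
    by (simp add: f_def comm linear_cmul[OF g(1)] complex_eq_iff)
  have f_i: "f (scaleC \<i> u) = \<i> * f u" for u
    by (simp add: f_def scaleC_scaleC neg_one linear_neg[OF g(1)] complex_eq_iff)
  have f_scaleC: "f (scaleC a u) = a * f u" for a u
  proof -
    have "scaleC a u = Re a *\<^sub>R u + Im a *\<^sub>R scaleC \<i> u"
      by (metis complex_eq mult.commute scaleC_add_left scaleC_of_real scaleC_scaleC)
    then have "f (scaleC a u) = Re a *\<^sub>R f u + Im a *\<^sub>R (\<i> * f u)"
      by (simp add: f_add f_scaleR f_i)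
    then show ?thesis by (simp add: complex_eq_iff)
  qed
  have f_norm: "norm (f u) \<le> norm u" for u
  proof (cases "f u = 0")
    case False
    \<comment> \<open>The rotation by \<open>a\<close> makes the value of \<open>f\<close> real and nonnegative.\<close>
    define a where "a = cnj (f u) / cmod (f u)"
    have "cmod a = 1" using False by (simp add: a_def norm_divide)
    have "a * f u = complex_of_real (cmod (f u))"
      using False by (simp add: a_def complex_norm_square[symmetric] mult.commute power2_eq_square
        flip: complex_norm_square)
    then have "cmod (f u) = Re (f (scaleC a u))" by (simp add: f_scaleC)
    also have "\<dots> = g (scaleC a u)" by (simp add: f_def)
    also have "\<dots> \<le> norm u" using g(2)[of "scaleC a u"] \<open>cmod a = 1\<close> by (simp add: norm_scaleC)
    finally show ?thesis .
  qed simp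
  have "bounded_linear f"
    using f_add f_scaleR f_norm by (intro bounded_linear_intro[where K=1]) auto
  moreover have "onorm f \<le> 1" by (rule onorm_bound) (use f_norm in simp_all)
  ultimately have "f \<in> dual_ball scaleC" by (simp add: dual_ball_def f_scaleC)
  moreover have "f (y j) = (- 1) ^ j * of_real L" for j
  proof -
    have "g (y j) = (- 1) ^ j * L" "g (scaleC \<i> (y j)) = 0"
      using g(3)[of 1 j] g(3)[of \<i> j] by (simp_all add: one)
    then have "f (y j) = complex_of_real ((- 1) ^ j * L)" by (simp add: f_def complex_eq_iff)
    then show ?thesis by simp
  qed
  ultimately show ?thesis by blast
qed

section \<open>Separated subsequences and functionals with large oscillation\<close>

lemma separated_subsequence:
  fixes x :: "nat \<Rightarrow> 'a::real_normed_vector"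
  assumes x: "bounded (range x)" and t: "t < ca_tilde x"
  shows "\<exists>r::nat \<Rightarrow> nat. strict_mono r \<and> (\<forall>n m. n \<noteq> m \<longrightarrow> t < norm (x (r n) - x (r m)))"
proof (cases "t < 0")
  case True
  then show ?thesis
    using strict_mono_id order_less_le_trans[OF _ norm_ge_zero] by blast
next
  case False
  define col where "col = (\<lambda>A. if \<exists>n m. A = {n, m} \<and> t < norm (x n - x m) then 1 else 0 :: nat)"
  have col: "col {n, m} = 1 \<longleftrightarrow> t < norm (x n - x m)" for n m
    unfolding col_def by (auto simp: doubleton_eq_iff norm_minus_commute)
  have "\<forall>n\<in>UNIV. \<forall>m\<in>UNIV. n \<noteq> m \<longrightarrow> col {n, m} < 2" by (simp add: col_def)
  from Ramsey2[OF infinite_UNIV_nat this] obtain Y q where Y: "infinite Y"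
    "\<forall>n\<in>Y. \<forall>m\<in>Y. n \<noteq> m \<longrightarrow> col {n, m} = q" by (elim exE conjE) (rule that)
  define r where "r = enumerate Y"
  have r: "strict_mono r" unfolding r_def using Y(1) by (rule strict_mono_enumerate)
  have q: "col {r n, r m} = q" if "n \<noteq> m" for n m
    using that Y enumerate_in_set[OF Y(1)] strict_mono_eq[OF r] by (simp add: r_def)
  show ?thesis
  proof (cases "q = 1")
    case True
    have "t < norm (x (r n) - x (r m))" if "n \<noteq> m" for n m
      using q[OF that] col[of "r n" "r m"] True by simp
    with r show ?thesis by blast
  next
    case qn: False
    have "ca (x \<circ> r) \<le> t"
    proof (rule ca_leI[OF bounded_range_subseq[OF x]])
      fix k l
      show "dist ((x \<circ> r) k) ((x \<circ> r) l) \<le> t"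
        using q[of k l] qn col[of "r k" "r l"] False by (cases "k = l") (auto simp: dist_norm)
    qed
    then show ?thesis using t ca_tilde_le_ca[OF x r] by simp
  qed
qed

lemma norm_normalized_diff_ge:
  fixes u v :: "'a::real_normed_vector"
  assumes "norm u > 0" "norm v > 0"
  shows "(norm (u - v) - \<bar>norm u - norm v\<bar>) / norm u \<le> norm (u /\<^sub>R norm u - v /\<^sub>R norm v)"
proof -
  have "(u - v) /\<^sub>R norm u = (u /\<^sub>R norm u - v /\<^sub>R norm v) + (1 / norm v - 1 / norm u) *\<^sub>R v"
    by (simp add: algebra_simps inverse_eq_divide)
  then have "norm ((u - v) /\<^sub>R norm u) \<le> norm (u /\<^sub>R norm u - v /\<^sub>R norm v)
      + norm ((1 / norm v - 1 / norm u) *\<^sub>R v)"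
    by (metis norm_triangle_ineq)
  moreover have "norm ((1 / norm v - 1 / norm u) *\<^sub>R v) = \<bar>norm u - norm v\<bar> / norm u"
  proof -
    have "(1 / norm v - 1 / norm u) * norm v = (norm u - norm v) / norm u"
      using assms by (simp add: field_simps)
    then have "\<bar>1 / norm v - 1 / norm u\<bar> * norm v = \<bar>(norm u - norm v) / norm u\<bar>"
      using assms by (metis abs_mult abs_norm_cancel)
    then show ?thesis using assms by simp
  qed
  moreover have "norm ((u - v) /\<^sub>R norm u) = norm (u - v) / norm u" by (simp add: divide_inverse mult.commute)
  ultimately show ?thesis by (simp add: diff_divide_distrib)
qed

lemma alternating_le_delta:
  fixes s :: "'k::real_normed_field \<Rightarrow> 'a::real_normed_vector \<Rightarrow> 'a"
  assumes x: "bounded (range x)" and r: "strict_mono r" and L: "L \<ge> 0"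
    and f: "f \<in> dual_ball s" "\<And>j. f (x (r j)) = (- 1) ^ j * of_real L"
  shows "2 * L \<le> delta s x"
proof -
  have "2 * L \<le> ca (\<lambda>n. f (x n))"
  proof (rule ca_geI[OF bounded_range_dual[OF x f(1)]])
    fix n
    have "r (2 * n) \<ge> n" "r (2 * n + 1) \<ge> n"
      using strict_mono_imp_increasing[OF r, of "2 * n"] strict_mono_imp_increasing[OF r, of "2 * n + 1"]
      by linarith+
    moreover have "dist (f (x (r (2 * n)))) (f (x (r (2 * n + 1)))) = 2 * L"
    proof -
      have "f (x (r (2 * n))) - f (x (r (2 * n + 1))) = of_real (2 * L)"
        unfolding f(2) by simp
      then show ?thesis using L by (simp only: dist_norm norm_of_real abs_of_nonneg)
    qed
    ultimately show "\<exists>k\<ge>n. \<exists>l\<ge>n. 2 * L \<le> dist (f (x k)) (f (x l))"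
      by (metis order_refl)
  qed
  then show ?thesis using ca_dual_le_delta[OF x f(1)] by linarith
qed

text \<open>
  The two properties of the scalar multiplication that the passage from \<open>property_vi\<close> to
  \<open>property_iv\<close> needs. The second one states that a lower \<open>\<ell>\<^sub>1\<close>-estimate with constant \<open>L\<close>
  provides a functional of the dual ball with alternating values plus and minus \<open>L\<close>.
\<close>

locale l1_scalars =
  fixes s :: "'k::real_normed_field \<Rightarrow> 'a::real_normed_vector \<Rightarrow> 'a"
  assumes scale_real: "s a (t *\<^sub>R u) = s (a * of_real t) u"
    and alternating_functional: "\<lbrakk>L \<ge> 0; \<And>m \<alpha>. L * (\<Sum>j<m. norm (\<alpha> j)) \<le> norm (\<Sum>j<m. s (\<alpha> j) (y j))\<rbrakk>
      \<Longrightarrow> \<exists>f\<in>dual_ball s. \<forall>j. f (y j) = (- 1) ^ j * of_real L"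
begin

text \<open>
  All losses are measured by one parameter \<open>t\<close>: the separation is \<open>\<theta> - t\<close>, the norms differ from
  \<open>l\<close> by less than \<open>t\<close>, and \<open>t\<close> is also the tolerance in \<open>property_vi\<close>. For \<open>t\<close> tending to 0 the lower
  bound tends to \<open>\<theta> / c\<close>.
\<close>

lemma delta_ge_of_almost_constant_norm:
  assumes c: "c > 0" and vi: "property_vi s c" and x: "bounded (range x)"
    and t: "0 < t" "t < l" "3 * t < \<theta>" and \<theta>: "\<theta> = ca_tilde x"
    and near: "\<And>n. n \<ge> N \<Longrightarrow> \<bar>norm (x n) - l\<bar> < t"
  shows "2 * ((l - t) / (2 * c / ((\<theta> - 3 * t) / (l + t)) + t)) \<le> delta s x"
proof -
  obtain r0 :: "nat \<Rightarrow> nat" where r0: "strict_mono r0"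
      "\<And>n m. n \<noteq> m \<Longrightarrow> \<theta> - t < norm (x (r0 n) - x (r0 m))"
    using separated_subsequence[OF x, of "\<theta> - t"] t \<theta> by auto
  define r where "r = (\<lambda>n. r0 (n + N))"
  have r: "strict_mono r" using r0(1) by (simp add: r_def strict_mono_def)
  have rN: "r n \<ge> N" for n
    using strict_mono_imp_increasing[OF r0(1), of "n + N"] by (simp add: r_def)
  have sep: "\<theta> - t < norm (x (r n) - x (r m))" if "n \<noteq> m" for n m
    using r0(2)[of "n + N" "m + N"] that by (simp add: r_def)
  have nr: "l - t < norm (x (r n))" "norm (x (r n)) < l + t" for n
    using near[OF rN, of n] by linarith+
  have pos: "norm (x (r n)) > 0" for n using nr(1)[of n] t by linarith
  define y where "y = (\<lambda>n. x (r n) /\<^sub>R norm (x (r n)))"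
  \<comment> \<open>Of the separation \<open>\<theta> - t\<close>, at most \<open>2 * t\<close> is lost because the norms of two terms may differ.\<close>
  define \<sigma> where "\<sigma> = (\<theta> - 3 * t) / (l + t)"
  have \<sigma>0: "\<sigma> > 0" unfolding \<sigma>_def using t by simp
  have ny: "norm (y n) = 1" for n using pos[of n] by (simp add: y_def)
  have sy: "\<sigma> \<le> norm (y n - y m)" if "n \<noteq> m" for n m
  proof -
    have "\<theta> - 3 * t \<le> norm (x (r n) - x (r m)) - \<bar>norm (x (r n)) - norm (x (r m))\<bar>"
      using sep[OF that] nr[of n] nr[of m] by linarith
    then have "\<sigma> \<le> (norm (x (r n) - x (r m)) - \<bar>norm (x (r n)) - norm (x (r m))\<bar>) / norm (x (r n))"
      unfolding \<sigma>_def using t nr(2)[of n] pos[of n] by (intro frac_le) auto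
    also have "\<dots> \<le> norm (y n - y m)"
      unfolding y_def by (rule norm_normalized_diff_ge[OF pos pos])
    finally show ?thesis .
  qed
  have "\<sigma> \<le> 2" using sy[of 0 1] norm_triangle_ineq4[of "y 0" "y 1"] ny[of 0] ny[of 1] by simp
  moreover have "normalized y" "separated \<sigma> y" using ny sy by (simp_all add: normalized_def separated_def)
  ultimately obtain q :: "nat \<Rightarrow> nat" where q: "strict_mono q" "equivalent_l1_basis s (2 * c / \<sigma> + t) (y \<circ> q)"
    using vi \<sigma>0 t(1) unfolding property_vi_def by (meson greaterThanAtMost_iff)
  define K where "K = 2 * c / \<sigma> + t"
  have K: "K > 0" unfolding K_def using c \<sigma>0 t(1) by (simp add: add_pos_pos)
  define L where "L = (l - t) / K"
  have L: "L \<ge> 0" using K t by (simp add: L_def)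
  have "L * (\<Sum>j<m. norm (\<alpha> j)) \<le> norm (\<Sum>j<m. s (\<alpha> j) (x (r (q j))))" for m \<alpha>
  proof -
    \<comment> \<open>The factors undo the normalization.\<close>
    define \<beta> where "\<beta> = (\<lambda>j. \<alpha> j * of_real (norm (x (r (q j)))))"
    have "x (r (q j)) = norm (x (r (q j))) *\<^sub>R y (q j)" for j using pos[of "q j"] by (simp add: y_def)
    then have "s (\<alpha> j) (x (r (q j))) = s (\<beta> j) (y (q j))" for j
      unfolding \<beta>_def by (metis scale_real)
    then have eq: "(\<Sum>j<m. s (\<alpha> j) (x (r (q j)))) = (\<Sum>j<m. s (\<beta> j) (y (q j)))" by simp
    have "(l - t) * (\<Sum>j<m. norm (\<alpha> j)) \<le> (\<Sum>j<m. norm (\<beta> j))"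
      unfolding sum_distrib_left
    proof (rule sum_mono)
      fix j
      have "(l - t) * norm (\<alpha> j) \<le> norm (x (r (q j))) * norm (\<alpha> j)"
        using nr(1)[of "q j"] by (intro mult_right_mono) auto
      then show "(l - t) * norm (\<alpha> j) \<le> norm (\<beta> j)" by (simp add: \<beta>_def norm_mult mult.commute)
    qed
    then have "L * (\<Sum>j<m. norm (\<alpha> j)) \<le> 1 / K * (\<Sum>j<m. norm (\<beta> j))"
      using K by (simp add: L_def divide_right_mono)
    also have "\<dots> \<le> norm (\<Sum>j<m. s (\<beta> j) (y (q j)))"
      using q(2) by (simp add: equivalent_l1_basis_def K_def)
    finally show ?thesis unfolding eq .
  qed
  from alternating_functional[OF L this] obtain f where
    f: "f \<in> dual_ball s" "\<And>j. f (x (r (q j))) = (- 1) ^ j * of_real L" by blast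
  have "2 * L \<le> delta s x"
    by (rule alternating_le_delta[OF x strict_mono_o[OF r q(1)] L f(1)]) (simp add: f(2))
  then show ?thesis by (simp add: L_def K_def \<sigma>_def)
qed

lemma ca_tilde_le_delta_if_norms_converge:
  assumes c: "c > 0" and vi: "property_vi s c" and x: "bounded (range x)"
    and lim: "(\<lambda>n. norm (x n)) \<longlonglongrightarrow> l"
  shows "ca_tilde x \<le> c * delta s x"
proof (cases "ca_tilde x > 0")
  case False
  moreover have "0 \<le> c * delta s x" using c delta_nonneg[OF x, of s] by simp
  ultimately show ?thesis by linarith
next
  case True
  define \<theta> where "\<theta> = ca_tilde x"
  have \<theta>: "\<theta> > 0" using True by (simp add: \<theta>_def)
  have "l \<ge> 0" using lim by (rule LIMSEQ_le_const) auto
  moreover have "l \<noteq> 0"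
  proof
    \<comment> \<open>A sequence that converges to 0 has no separated subsequence.\<close>
    assume "l = 0"
    obtain r :: "nat \<Rightarrow> nat" where r: "strict_mono r"
        "\<And>n m. n \<noteq> m \<Longrightarrow> \<theta> / 2 < norm (x (r n) - x (r m))"
      using separated_subsequence[OF x, of "\<theta> / 2"] \<theta> \<theta>_def by auto
    have "(\<lambda>n. norm (x (r n))) \<longlonglongrightarrow> 0"
      using LIMSEQ_subseq_LIMSEQ[OF lim r(1)] \<open>l = 0\<close> by (simp add: o_def)
    then have "\<forall>\<^sub>F n in sequentially. norm (x (r n)) < \<theta> / 4"
      using \<theta> by (intro order_tendstoD(2)) auto
    then obtain n where "\<And>k. k \<ge> n \<Longrightarrow> norm (x (r k)) < \<theta> / 4"
      unfolding eventually_sequentially by blast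
    from this[of n] this[of "Suc n"] r(2)[of n "Suc n"] norm_triangle_ineq4[of "x (r n)" "x (r (Suc n))"]
    show False by simp
  qed
  ultimately have l: "l > 0" by simp
  define F where "F = (\<lambda>t. 2 * ((l - t) / (2 * c / ((\<theta> - 3 * t) / (l + t)) + t)))"
  have "(F \<longlongrightarrow> 2 * ((l - 0) / (2 * c / ((\<theta> - 3 * 0) / (l + 0)) + 0))) (at_right 0)"
    unfolding F_def using l \<theta> c by (intro tendsto_intros) auto
  then have "(F \<longlongrightarrow> \<theta> / c) (at_right 0)" using l \<theta> c by simp
  moreover have "\<forall>\<^sub>F t in at_right 0. F t \<le> delta s x"
    unfolding eventually_at_right_field
  proof (intro exI[of _ "min l (\<theta> / 3)"] conjI allI impI)
    fix t assume t: "0 < t" "t < min l (\<theta> / 3)"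
    obtain N where "\<And>n. n \<ge> N \<Longrightarrow> \<bar>norm (x n) - l\<bar> < t"
      using LIMSEQ_D[OF lim t(1)] by auto
    then show "F t \<le> delta s x"
      unfolding F_def using t \<theta>_def by (intro delta_ge_of_almost_constant_norm[OF c vi x]) auto
  qed (use l \<theta> in auto)
  ultimately have "\<theta> / c \<le> delta s x" by (intro tendsto_upperbound) auto
  then show ?thesis using c by (simp add: \<theta>_def field_simps)
qed

lemma property_vi_imp_iv:
  assumes c: "c > 0" and vi: "property_vi s c"
  shows "property_iv s c"
  unfolding property_iv_def
proof (intro allI impI)
  fix x :: "nat \<Rightarrow> 'a" assume x: "bounded (range x)"
  have "ca_tilde x / c \<le> delta_tilde s x"
  proof (rule delta_tilde_geI)
    fix r :: "nat \<Rightarrow> nat" assume r: "strict_mono r"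
    have "bounded (range (\<lambda>n. norm (x (r n))))" using x by (auto simp: bounded_iff)
    then obtain l q where q: "strict_mono q" "((\<lambda>n. norm (x (r n))) \<circ> q) \<longlonglongrightarrow> l"
      using bounded_imp_convergent_subsequence by blast
    have "ca_tilde x \<le> ca_tilde (x \<circ> (r \<circ> q))"
      by (rule ca_tilde_mono_subseq[OF x strict_mono_o[OF r q(1)]])
    also have "\<dots> \<le> c * delta s (x \<circ> (r \<circ> q))"
      using q(2) by (intro ca_tilde_le_delta_if_norms_converge[OF c vi, where l=l] bounded_range_subseq[OF x])
        (simp add: o_def)
    also have "\<dots> \<le> c * delta s (x \<circ> r)"
      using delta_subseq_le[OF bounded_range_subseq[OF x, of r] q(1), of s] c by (simp add: comp_assoc)
    finally show "ca_tilde x / c \<le> delta s (x \<circ> r)" using c by (simp add: field_simps)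
  qed
  then show "ca_tilde x \<le> c * delta_tilde s x" using c by (simp add: field_simps)
qed

end

lemma l1_scalars_scaleR: "l1_scalars (scaleR :: real \<Rightarrow> 'a::real_normed_vector \<Rightarrow> 'a)"
  by unfold_locales (simp, rule alternating_functional_real)

lemma l1_scalars_scaleC: "l1_scalars (scaleC :: complex \<Rightarrow> 'a::complex_normed_vector \<Rightarrow> 'a)"
  by unfold_locales
    (simp add: scaleC_of_real[symmetric] scaleC_scaleC, rule alternating_functional_complex)

section \<open>Choice of signs\<close>

lemma ex_signs_real:
  fixes \<alpha> :: "nat \<Rightarrow> real"
  shows "\<exists>\<sigma>. (\<forall>j. \<sigma> j \<in> {1, - 1}) \<and> 1 * (\<Sum>j<m. norm (\<alpha> j)) \<le> norm (\<Sum>j<m. \<sigma> j * \<alpha> j)"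
proof (intro exI conjI allI)
  let ?\<sigma> = "\<lambda>j. if \<alpha> j \<ge> 0 then 1 else - 1 :: real"
  show "?\<sigma> j \<in> {1, - 1}" for j by simp
  have "(\<Sum>j<m. ?\<sigma> j * \<alpha> j) = (\<Sum>j<m. norm (\<alpha> j))" by (rule sum.cong) auto
  then show "1 * (\<Sum>j<m. norm (\<alpha> j)) \<le> norm (\<Sum>j<m. ?\<sigma> j * \<alpha> j)" by simp
qed

lemma has_integral_abs_cos_shift:
  assumes "\<bar>\<phi>\<bar> \<le> pi / 2"
  shows "((\<lambda>\<theta>. \<bar>cos (\<theta> + \<phi>)\<bar>) has_integral 2) {0..pi}"
proof -
  have "((\<lambda>\<theta>. \<bar>cos (\<theta> + \<phi>)\<bar>) has_integral (sin (pi / 2 - \<phi> + \<phi>) - sin (0 + \<phi>))) {0..pi / 2 - \<phi>}"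
  proof (rule has_integral_eq)
    show "((\<lambda>\<theta>. cos (\<theta> + \<phi>)) has_integral (sin (pi / 2 - \<phi> + \<phi>) - sin (0 + \<phi>))) {0..pi / 2 - \<phi>}"
      using assms by (intro fundamental_theorem_of_calculus)
        (auto simp flip: has_real_derivative_iff_has_vector_derivative intro!: derivative_eq_intros)
    fix \<theta> assume "\<theta> \<in> {0..pi / 2 - \<phi>}"
    then have "cos (\<theta> + \<phi>) \<ge> 0" using assms by (intro cos_ge_zero) auto
    then show "cos (\<theta> + \<phi>) = \<bar>cos (\<theta> + \<phi>)\<bar>" by simp
  qed
  moreover
  have "((\<lambda>\<theta>. \<bar>cos (\<theta> + \<phi>)\<bar>) has_integral (- sin (pi + \<phi>) - - sin (pi / 2 - \<phi> + \<phi>))) {pi / 2 - \<phi>..pi}"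
  proof (rule has_integral_eq)
    show "((\<lambda>\<theta>. - cos (\<theta> + \<phi>)) has_integral (- sin (pi + \<phi>) - - sin (pi / 2 - \<phi> + \<phi>))) {pi / 2 - \<phi>..pi}"
      using assms by (intro fundamental_theorem_of_calculus)
        (auto simp flip: has_real_derivative_iff_has_vector_derivative intro!: derivative_eq_intros)
    fix \<theta> assume "\<theta> \<in> {pi / 2 - \<phi>..pi}"
    then have "cos (\<theta> + \<phi> - pi) \<ge> 0" using assms by (intro cos_ge_zero) auto
    then show "- cos (\<theta> + \<phi>) = \<bar>cos (\<theta> + \<phi>)\<bar>" by (simp add: cos_diff)
  qed
  ultimately have "((\<lambda>\<theta>. \<bar>cos (\<theta> + \<phi>)\<bar>) has_integral
      (sin (pi / 2 - \<phi> + \<phi>) - sin (0 + \<phi>) + (- sin (pi + \<phi>) - - sin (pi / 2 - \<phi> + \<phi>)))) {0..pi}"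
    using assms by (intro has_integral_combine[where c="pi / 2 - \<phi>"]) auto
  then show ?thesis by simp
qed

text \<open>
  Multiplying \<open>z\<close> by -1 does not affect the integrand, so the argument of \<open>z\<close> may be assumed to lie
  between \<open>- pi / 2\<close> and \<open>pi / 2\<close>, where the cosine changes sign at a single point of the range of integration.
\<close>

lemma has_integral_abs_Re_rotation:
  "((\<lambda>\<theta>. \<bar>Re (cis \<theta> * z)\<bar>) has_integral 2 * cmod z) {0..pi}"
proof -
  have *: "((\<lambda>\<theta>. \<bar>Re (cis \<theta> * z)\<bar>) has_integral 2 * cmod z) {0..pi}" if "Re z \<ge> 0" for z
  proof (cases "z = 0")
    case False
    have "\<bar>Arg z\<bar> \<le> pi / 2" using False that Re_Ln_pos_le[OF False] by (simp add: Arg_eq_Im_Ln)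
    from has_integral_mult_right[OF has_integral_abs_cos_shift[OF this], of "cmod z"]
    have "((\<lambda>\<theta>. cmod z * \<bar>cos (\<theta> + Arg z)\<bar>) has_integral cmod z * 2) {0..pi}" .
    moreover have "\<bar>Re (cis \<theta> * z)\<bar> = cmod z * \<bar>cos (\<theta> + Arg z)\<bar>" for \<theta>
    proof -
      have "cis \<theta> * z = rcis (cmod z) (\<theta> + Arg z)"
        by (metis cis_rcis_eq mult.left_neutral rcis_cmod_Arg rcis_mult)
      then show ?thesis by (simp add: abs_mult)
    qed
    ultimately show ?thesis by (simp add: mult.commute)
  qed simp
  show ?thesis
  proof (cases "Re z \<ge> 0")
    case False
    then have "((\<lambda>\<theta>. \<bar>Re (cis \<theta> * - z)\<bar>) has_integral 2 * cmod (- z)) {0..pi}" by (intro *) simp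
    moreover have "\<bar>Re (cis \<theta> * - z)\<bar> = \<bar>Re (cis \<theta> * z)\<bar>" for \<theta>
      by (simp only: mult_minus_right uminus_complex.sel abs_minus_cancel)
    ultimately show ?thesis by (simp only: norm_minus_cancel)
  qed (rule *)
qed

text \<open>
  For a rotation by \<open>\<theta>\<close>, the signs of the real parts of \<open>cis \<theta> * \<alpha> j\<close> bound the norm of the signed
  sum below by the sum of the absolute values of these real parts. The mean of this
  sum over \<open>\<theta> \<in> {0..pi}\<close> is \<open>2 / pi\<close> times the sum of the norms.
\<close>

lemma ex_signs_complex:
  fixes \<alpha> :: "nat \<Rightarrow> complex"
  shows "\<exists>\<sigma>. (\<forall>j. \<sigma> j \<in> {1, - 1}) \<and> 2 / pi * (\<Sum>j<m. norm (\<alpha> j)) \<le> norm (\<Sum>j<m. \<sigma> j * \<alpha> j)"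
proof -
  define F where "F = (\<lambda>\<theta>. \<Sum>j<m. \<bar>Re (cis \<theta> * \<alpha> j)\<bar>)"
  have int: "(F has_integral (\<Sum>j<m. 2 * cmod (\<alpha> j))) {0..pi}"
    unfolding F_def by (intro has_integral_sum has_integral_abs_Re_rotation) auto
  have "continuous_on {0..pi} F"
    unfolding F_def by (intro continuous_intros)
  then have "\<exists>\<theta>\<in>{0..pi}. \<forall>t\<in>{0..pi}. F t \<le> F \<theta>"
    by (intro continuous_attains_sup) auto
  then obtain \<theta> where \<theta>: "\<And>t. t \<in> {0..pi} \<Longrightarrow> F t \<le> F \<theta>" by blast
  have "(\<Sum>j<m. 2 * cmod (\<alpha> j)) \<le> pi * F \<theta>"
    using has_integral_le[OF int has_integral_const_real[of "F \<theta>" 0 pi] \<theta>] by simp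
  then have "2 / pi * (\<Sum>j<m. norm (\<alpha> j)) \<le> F \<theta>" by (simp add: sum_distrib_left[symmetric] field_simps)
  define \<sigma> where "\<sigma> = (\<lambda>j. if Re (cis \<theta> * \<alpha> j) \<ge> 0 then 1 else - 1 :: complex)"
  have "F \<theta> = Re (\<Sum>j<m. \<sigma> j * (cis \<theta> * \<alpha> j))"
    unfolding F_def Re_sum by (rule sum.cong) (auto simp: \<sigma>_def)
  also have "(\<Sum>j<m. \<sigma> j * (cis \<theta> * \<alpha> j)) = cis \<theta> * (\<Sum>j<m. \<sigma> j * \<alpha> j)"
    by (simp add: sum_distrib_left mult_ac)
  also have "Re \<dots> \<le> norm (\<Sum>j<m. \<sigma> j * \<alpha> j)"
    by (rule order_trans[OF complex_Re_le_cmod]) (simp add: norm_mult)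
  finally have "2 / pi * (\<Sum>j<m. norm (\<alpha> j)) \<le> norm (\<Sum>j<m. \<sigma> j * \<alpha> j)"
    using \<open>_ \<le> F \<theta>\<close> by linarith
  then show ?thesis by (intro exI[of _ \<sigma>]) (simp add: \<sigma>_def)
qed

section \<open>The implications between the two properties\<close>

theorem proposition5p6:
  fixes c :: real
  assumes "c \<ge> 1"
  shows "(property_iv (scaleR :: real \<Rightarrow> 'a::banach \<Rightarrow> 'a) c \<longleftrightarrow>
            property_vi (scaleR :: real \<Rightarrow> 'a \<Rightarrow> 'a) c) \<and>
         (property_vi (scaleC :: complex \<Rightarrow> 'b::complex_banach \<Rightarrow> 'b) c \<longrightarrow>
            property_iv (scaleC :: complex \<Rightarrow> 'b \<Rightarrow> 'b) c) \<and>
         (property_iv (scaleC :: complex \<Rightarrow> 'b \<Rightarrow> 'b) c \<longrightarrow>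
            property_vi (scaleC :: complex \<Rightarrow> 'b \<Rightarrow> 'b) (pi * c / 2))"
proof -
  have c: "c > 0" using assms by simp
  have "property_vi (scaleR :: real \<Rightarrow> 'a \<Rightarrow> 'a) c" if "property_iv (scaleR :: real \<Rightarrow> 'a \<Rightarrow> 'a) c"
    using property_iv_imp_vi[OF zero_less_one c ex_signs_real that] by simp
  moreover have "property_vi (scaleC :: complex \<Rightarrow> 'b \<Rightarrow> 'b) (pi * c / 2)"
    if "property_iv (scaleC :: complex \<Rightarrow> 'b \<Rightarrow> 'b) c"
    using property_iv_imp_vi[OF _ c ex_signs_complex that] by (simp add: mult.commute)
  ultimately show ?thesis
    using l1_scalars.property_vi_imp_iv[OF l1_scalars_scaleR c]
      l1_scalars.property_vi_imp_iv[OF l1_scalars_scaleC c] by blast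
qed

end
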